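(* Let $H$ be an infinite dimensional separable Hilbert space and $I$ a countable index set. Let $f=\{f_i\}_{i\in I}$ be a frame for $H$, $u=\{u_i\}_{i\in I}$ a Parseval frame for $H$, and $v=\{v_i\}_{i\in I}$ a Parseval frame for $H$ which is not an orthonormal basis. Suppose $w=\{w_j\}_{j\in I}$ is a weak R-dual of $f$ with respect to $u$ and $v$. Let $y=\{y_i\}_{i\in I}$ be given by $y_i:=\sum_{k\in I}\langle u_k,f_i\rangle\widetilde w_k$, where $\{\widetilde w_k\}_{k\in I}$ is the canonical dual of the frame sequence $w$. Then: (i) $\dim((span\{w_j\})^\perp)\le\dim(Ker(T_y))$; (ii) if $\dim((span\{w_j\})^\perp)<\infty$, then $\dim((span\{w_j\})^\perp)<\dim(Ker(T_y))$.
   Context: Inner products are linear in the first variable. A sequence $\{f_i\}_{i\in I}$ in $H$ is a frame for $H$ if there are $0<A\le B<\infty$ with $A\|x\|^2\le\sum_{i}|\langle x,f_i\rangle|^2\le B\|x\|^2$ for all $x\in H$; it is a Parseval frame if one can take $A=B=1$. A sequence is a frame sequence if it is a frame for its closed linear span. The canonical dual of a frame sequence $w$ is $\widetilde w_j=S_w^{-1}w_j$, where $S_w g=\sum_j\langle g,w_j\rangle w_j$ is the frame operator of $w$ on $\overline{span}\{w_j\}$. $T_y:\ell^2(I)\to H$, $T_y(\{c_i\})=\sum_i c_iy_i$, is the synthesis operator of $y$. Dimensions are Hilbert space dimensions (finite or $\infty$; all spaces are separable). For sequences $g,h$ in $H$ indexed by $I$, $G(g,h)$ denotes the matrix $(\langle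 g_i,h_j\rangle)_{i,j\in I}$, $G(g,h)^t$ its transpose, and $\mathcal I$ the infinite identity matrix. Weak R-dual: let $u,v$ be Parseval frames for $H$ and $f$ a sequence in $H$ such that $\sum_{i\in I}|\langle f_i,u_j\rangle|^2<\infty$ for all $j\in I$ and $(G(v,v)^t-\mathcal I)G(f,u)=\mathbf 0$ (i.e. $\sum_{k}\langle v_k,v_i\rangle\langle f_k,u_j\rangle=\langle f_i,u_j\rangle$ for all $i,j$). Then the sequence $w=\{w_j\}_{j\in I}$ given by $w_j=\sum_{i\in I}\langle f_i,u_j\rangle v_i$ is called the weak R-dual of $f$ with respect to $u$ and $v$. It is known (Li and Dong) that a weak R-dual of a frame is a frame sequence, so the canonical dual $\widetilde w$ and the sequence $y$ are well defined. *)

theory Defs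
  imports "HOL-Analysis.Analysis" "HOL-Library.Extended_Nat"
begin

section \<open>Complex inner product spaces\<close>

text \<open>
  The complex inner product is linear in the first and conjugate-linear in the second argument.
  Its real part is the inner product of the underlying real inner product space, so that
  \<open>cinner x x = (norm x)\<^sup>2\<close>, and the norm, topology and infinite sums are those of the library.
\<close>

class complex_inner = real_inner +
  fixes scaleC :: "complex \<Rightarrow> 'a \<Rightarrow> 'a"  (infixr \<open>*\<^sub>C\<close> 75)
    and cinner :: "'a \<Rightarrow> 'a \<Rightarrow> complex"
  assumes scaleC_add_right: "a *\<^sub>C (x + y) = a *\<^sub>C x + a *\<^sub>C y"
    and scaleC_add_left: "(a + b) *\<^sub>C x = a *\<^sub>C x + b *\<^sub>C x"
    and scaleC_scaleC: "a *\<^sub>C b *\<^sub>C x = (a * b) *\<^sub>C x"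
    and scaleC_one: "1 *\<^sub>C x = x"
    and scaleR_scaleC: "r *\<^sub>R x = complex_of_real r *\<^sub>C x"
    and cinner_commute: "cinner x y = cnj (cinner y x)"
    and cinner_add_left: "cinner (x + y) z = cinner x z + cinner y z"
    and cinner_scaleC_left: "cinner (a *\<^sub>C x) y = a * cinner x y"
    and inner_eq_Re_cinner: "inner x y = Re (cinner x y)"

lemma cinner_self: "cinner x x = complex_of_real ((norm x)\<^sup>2)"
  for x :: "'a::complex_inner"
proof -
  have "Im (cinner x x) = 0"
    using cinner_commute[of x x] by (metis cnj.simps(2) neg_equal_zero)
  then show ?thesis
    by (simp add: complex_eq_iff power2_norm_eq_inner inner_eq_Re_cinner)
qed

class chilbert = complex_inner + complete_space

global_interpretation complex_vector: vector_space "scaleC :: complex \<Rightarrow> 'a \<Rightarrow> 'a::complex_inner"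
  defines cspan = complex_vector.span
  by unfold_locales (simp_all add: scaleC_add_right scaleC_add_left scaleC_scaleC scaleC_one)

definition ortho_complement :: "'a::complex_inner set \<Rightarrow> 'a set"
  where "ortho_complement S = {x. \<forall>y\<in>S. cinner x y = 0}"

definition is_onb_on :: "'j set \<Rightarrow> ('j \<Rightarrow> 'a::complex_inner) \<Rightarrow> 'a set \<Rightarrow> bool"
  where "is_onb_on J e M \<longleftrightarrow>
    (\<forall>i\<in>J. \<forall>j\<in>J. cinner (e i) (e j) = of_bool (i = j)) \<and> closure (cspan (e ` J)) = M"

text \<open>Hilbert space dimension of a closed subspace, with all infinite cardinalities
  identified with \<open>\<infinity>\<close>: the number of elements of an orthonormal basis.\<close>

definition hdim :: "'a::complex_inner set \<Rightarrow> enat"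
  where "hdim M = (let E = (SOME E. is_onb_on E (\<lambda>x. x) M)
    in if finite E then enat (card E) else \<infinity>)"


section \<open>The space of square summable families\<close>

typedef 'i ell2 = "{c :: 'i \<Rightarrow> complex. (\<lambda>i. (cmod (c i))\<^sup>2) summable_on UNIV}"
  morphisms ell2_coeff Abs_ell2
  by (rule exI[of _ "\<lambda>_. 0"]) simp

setup_lifting type_definition_ell2

lemma square_summable_add:
  assumes "(\<lambda>i. (cmod (c i))\<^sup>2) summable_on A" "(\<lambda>i. (cmod (d i))\<^sup>2) summable_on A"
  shows "(\<lambda>i. (cmod (c i + d i))\<^sup>2) summable_on A"
proof (rule summable_on_comparison_test)
  show "(\<lambda>i. 2 * (cmod (c i))\<^sup>2 + 2 * (cmod (d i))\<^sup>2) summable_on A"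
    using assms by (intro summable_on_add summable_on_cmult_right)
  show "(cmod (c i + d i))\<^sup>2 \<le> 2 * (cmod (c i))\<^sup>2 + 2 * (cmod (d i))\<^sup>2" for i
  proof -
    have "(cmod (c i + d i))\<^sup>2 \<le> (cmod (c i) + cmod (d i))\<^sup>2"
      by (intro power_mono norm_triangle_ineq) auto
    also have "\<dots> \<le> 2 * (cmod (c i))\<^sup>2 + 2 * (cmod (d i))\<^sup>2"
      using sum_squares_bound[of "cmod (c i)" "cmod (d i)"] by (simp add: power2_sum)
    finally show ?thesis .
  qed
qed auto

lemma square_summable_scale:
  assumes "(\<lambda>i. (cmod (c i))\<^sup>2) summable_on A"
  shows "(\<lambda>i. (cmod (a * c i))\<^sup>2) summable_on A"
  using summable_on_cmult_right[OF assms, of "(cmod a)\<^sup>2"]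
  by (simp add: norm_mult power_mult_distrib)

lemma square_summable_mult:
  assumes "(\<lambda>i. (cmod (c i))\<^sup>2) summable_on A" "(\<lambda>i. (cmod (d i))\<^sup>2) summable_on A"
  shows "(\<lambda>i. c i * cnj (d i)) summable_on A"
proof -
  have "(\<lambda>i. norm (c i * cnj (d i))) summable_on A"
  proof (rule summable_on_comparison_test)
    show "(\<lambda>i. (cmod (c i))\<^sup>2 + (cmod (d i))\<^sup>2) summable_on A"
      using assms by (intro summable_on_add)
    show "norm (c i * cnj (d i)) \<le> (cmod (c i))\<^sup>2 + (cmod (d i))\<^sup>2" for i
    proof -
      have "0 \<le> cmod (c i) * cmod (d i)" by simp
      then show ?thesis
        using sum_squares_bound[of "cmod (c i)" "cmod (d i)"] unfolding norm_mult complex_mod_cnj by linarith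
    qed
  qed auto
  then show ?thesis
    using summable_on_iff_abs_summable_on_complex by blast
qed

lemma ell2_coeff_square_summable: "(\<lambda>i. (cmod (ell2_coeff c i))\<^sup>2) summable_on UNIV"
  using ell2_coeff[of c] by simp

lemma ell2_summable_cinner: "(\<lambda>i. ell2_coeff c i * cnj (ell2_coeff d i)) summable_on UNIV"
  by (intro square_summable_mult ell2_coeff_square_summable)

instantiation ell2 :: (type) complex_inner
begin

lift_definition zero_ell2 :: "'a ell2" is "\<lambda>_. 0" by simp
lift_definition plus_ell2 :: "'a ell2 \<Rightarrow> 'a ell2 \<Rightarrow> 'a ell2" is "\<lambda>c d i. c i + d i"
  by (rule square_summable_add)
lift_definition scaleC_ell2 :: "complex \<Rightarrow> 'a ell2 \<Rightarrow> 'a ell2" is "\<lambda>a c i. a * c i"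
  by (rule square_summable_scale)
definition uminus_ell2 :: "'a ell2 \<Rightarrow> 'a ell2" where "- c = (- 1) *\<^sub>C c" for c :: "'a ell2"
definition minus_ell2 :: "'a ell2 \<Rightarrow> 'a ell2 \<Rightarrow> 'a ell2" where "c - d = c + - d" for c d :: "'a ell2"
definition scaleR_ell2 :: "real \<Rightarrow> 'a ell2 \<Rightarrow> 'a ell2" where "r *\<^sub>R c = complex_of_real r *\<^sub>C c" for c :: "'a ell2"
definition cinner_ell2 :: "'a ell2 \<Rightarrow> 'a ell2 \<Rightarrow> complex"
  where "cinner c d = (\<Sum>\<^sub>\<infinity>i. ell2_coeff c i * cnj (ell2_coeff d i))" for c d :: "'a ell2"
definition inner_ell2 :: "'a ell2 \<Rightarrow> 'a ell2 \<Rightarrow> real" where "inner c d = Re (cinner c d)" for c d :: "'a ell2"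
definition norm_ell2 :: "'a ell2 \<Rightarrow> real" where "norm c = sqrt (inner c c)" for c :: "'a ell2"
definition sgn_ell2 :: "'a ell2 \<Rightarrow> 'a ell2" where "sgn c = inverse (norm c) *\<^sub>R c" for c :: "'a ell2"
definition dist_ell2 :: "'a ell2 \<Rightarrow> 'a ell2 \<Rightarrow> real" where "dist c d = norm (c - d)" for c d :: "'a ell2"
definition uniformity_ell2 :: "('a ell2 \<times> 'a ell2) filter"
  where [code del]: "uniformity_ell2 = (INF e\<in>{0<..}. principal {(x, y). dist x y < e})"
definition open_ell2 :: "'a ell2 set \<Rightarrow> bool"
  where [code del]: "open_ell2 U \<longleftrightarrow> (\<forall>x\<in>U. eventually (\<lambda>(x', y). x' = x \<longrightarrow> y \<in> U) uniformity)"

instance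
proof
  fix a b c :: "'a ell2" and r s :: real and z w :: complex
  show "a + b + c = a + (b + c)" by transfer (simp add: add.assoc)
  show "a + b = b + a" by transfer (simp add: add.commute)
  show "0 + a = a" by transfer simp
  show "- a + a = 0" unfolding uminus_ell2_def by transfer simp
  show "a - b = a + - b" by (rule minus_ell2_def)
  show C1: "z *\<^sub>C (a + b) = z *\<^sub>C a + z *\<^sub>C b" for z :: complex and a b :: "'a ell2"
    by transfer (simp add: distrib_left)
  show C2: "(z + w) *\<^sub>C a = z *\<^sub>C a + w *\<^sub>C a" for z w :: complex and a :: "'a ell2"
    by transfer (simp add: distrib_right)
  show C3: "z *\<^sub>C w *\<^sub>C a = (z * w) *\<^sub>C a" for z w :: complex and a :: "'a ell2"
    by transfer (simp add: mult.assoc)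
  show C4: "1 *\<^sub>C a = a" for a :: "'a ell2" by transfer simp
  show "r *\<^sub>R (a + b) = r *\<^sub>R a + r *\<^sub>R b" "(r + s) *\<^sub>R a = r *\<^sub>R a + s *\<^sub>R a"
    "r *\<^sub>R s *\<^sub>R a = (r * s) *\<^sub>R a" "1 *\<^sub>R a = a"
    by (simp_all add: scaleR_ell2_def C1 C2 C3 C4)
  show "r *\<^sub>R a = complex_of_real r *\<^sub>C a" by (rule scaleR_ell2_def)
  show "sgn a = inverse (norm a) *\<^sub>R a" by (rule sgn_ell2_def)
  show "dist a b = norm (a - b)" by (rule dist_ell2_def)
  show "uniformity = (INF e\<in>{0<..}. principal {(x, y). dist (x::'a ell2) y < e})"
    by (rule uniformity_ell2_def)
  show "open U \<longleftrightarrow> (\<forall>x\<in>U. \<forall>\<^sub>F (x', y) in uniformity. x' = x \<longrightarrow> y \<in> U)" for U :: "'a ell2 set"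
    by (rule open_ell2_def)
  show I1: "cinner a b = cnj (cinner b a)" for a b :: "'a ell2"
    by (simp add: cinner_ell2_def infsum_cnj[symmetric] mult.commute del: infsum_cnj)
  show I2: "cinner (a + b) c = cinner a c + cinner b c"
    by (simp add: cinner_ell2_def plus_ell2.rep_eq distrib_right infsum_add ell2_summable_cinner)
  show I3: "cinner (z *\<^sub>C a) b = z * cinner a b" for z :: complex and a b :: "'a ell2"
    by (simp add: cinner_ell2_def scaleC_ell2.rep_eq mult.assoc infsum_cmult_right ell2_summable_cinner)
  show "inner a b = Re (cinner a b)" by (rule inner_ell2_def)
  show "inner a b = inner b a" by (metis I1 inner_ell2_def cnj.simps(1))
  show "inner (a + b) c = inner a c + inner b c" by (simp add: inner_ell2_def I2)
  show "inner (r *\<^sub>R a) b = r * inner a b" by (simp add: inner_ell2_def scaleR_ell2_def I3)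
  have inner_self: "inner a a = (\<Sum>\<^sub>\<infinity>i. (cmod (ell2_coeff a i))\<^sup>2)"
    unfolding inner_ell2_def cinner_ell2_def infsum_Re[OF ell2_summable_cinner, symmetric] cmod_power2
    by (simp add: power2_eq_square)
  show "0 \<le> inner a a" unfolding inner_self by (rule infsum_nonneg) simp
  show "inner a a = 0 \<longleftrightarrow> a = 0"
  proof
    assume "inner a a = 0"
    then have "ell2_coeff a i = 0" for i
      using nonneg_infsum_le_0D[OF _ ell2_coeff_square_summable, of a i]
      unfolding inner_self by simp
    then show "a = 0" by (simp add: ell2_coeff_inject[symmetric] zero_ell2.rep_eq fun_eq_iff)
  qed (unfold inner_self, simp add: zero_ell2.rep_eq)
  show "norm a = sqrt (inner a a)" by (rule norm_ell2_def)
qed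

end


section \<open>Frames\<close>

text \<open>
  All infinite sums are unordered sums over the index type. Sums of vectors or scalars default to
  \<open>0\<close> when they do not converge; below they are only formed from square summable
  coefficients and Bessel sequences, in which case they do converge.
\<close>

definition has_frame_bounds :: "('i \<Rightarrow> 'a::complex_inner) \<Rightarrow> 'a set \<Rightarrow> real \<Rightarrow> real \<Rightarrow> bool"
  where "has_frame_bounds f M A B \<longleftrightarrow>
    (\<forall>x\<in>M. (\<lambda>i. (cmod (cinner x (f i)))\<^sup>2) summable_on UNIV \<and>
      A * (norm x)\<^sup>2 \<le> (\<Sum>\<^sub>\<infinity>i. (cmod (cinner x (f i)))\<^sup>2) \<and>
      (\<Sum>\<^sub>\<infinity>i. (cmod (cinner x (f i)))\<^sup>2) \<le> B * (norm x)\<^sup>2)"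

definition is_frame :: "('i \<Rightarrow> 'a::complex_inner) \<Rightarrow> bool"
  where "is_frame f \<longleftrightarrow> (\<exists>A B. 0 < A \<and> A \<le> B \<and> has_frame_bounds f UNIV A B)"

definition is_parseval_frame :: "('i \<Rightarrow> 'a::complex_inner) \<Rightarrow> bool"
  where "is_parseval_frame f \<longleftrightarrow> has_frame_bounds f UNIV 1 1"

definition synthesis :: "('i \<Rightarrow> 'a::complex_inner) \<Rightarrow> 'i ell2 \<Rightarrow> 'a"
  where "synthesis y c = (\<Sum>\<^sub>\<infinity>i. ell2_coeff c i *\<^sub>C y i)"

definition frame_operator :: "('i \<Rightarrow> 'a::complex_inner) \<Rightarrow> 'a \<Rightarrow> 'a"
  where "frame_operator w g = (\<Sum>\<^sub>\<infinity>j. cinner g (w j) *\<^sub>C w j)"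

text \<open>For a frame sequence \<open>w\<close>, the frame operator is a bijection of the closed span of \<open>w\<close>
  onto itself.\<close>

definition canonical_dual :: "('i \<Rightarrow> 'a::complex_inner) \<Rightarrow> 'i \<Rightarrow> 'a"
  where "canonical_dual w j = inv_into (closure (cspan (range w))) (frame_operator w) (w j)"


section \<open>Weak R-duals\<close>

definition gram :: "('i \<Rightarrow> 'a::complex_inner) \<Rightarrow> ('i \<Rightarrow> 'a) \<Rightarrow> 'i \<Rightarrow> 'i \<Rightarrow> complex"
  where "gram g h i j = cinner (g i) (h j)"

definition inf_mat_mult :: "('i \<Rightarrow> 'i \<Rightarrow> complex) \<Rightarrow> ('i \<Rightarrow> 'i \<Rightarrow> complex) \<Rightarrow> 'i \<Rightarrow> 'i \<Rightarrow> complex"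
  where "inf_mat_mult P Q i j = (\<Sum>\<^sub>\<infinity>k. P i k * Q k j)"

definition is_weak_R_dual ::
  "('i \<Rightarrow> 'a::complex_inner) \<Rightarrow> ('i \<Rightarrow> 'a) \<Rightarrow> ('i \<Rightarrow> 'a) \<Rightarrow> ('i \<Rightarrow> 'a) \<Rightarrow> bool"
  where "is_weak_R_dual w f u v \<longleftrightarrow>
    is_parseval_frame u \<and> is_parseval_frame v \<and>
    (\<forall>j. (\<lambda>i. (cmod (cinner (f i) (u j)))\<^sup>2) summable_on UNIV) \<and>
    inf_mat_mult (\<lambda>i k. gram v v k i - of_bool (i = k)) (gram f u) = (\<lambda>i j. 0) \<and>
    (\<forall>j. w j = (\<Sum>\<^sub>\<infinity>i. cinner (f i) (u j) *\<^sub>C v i))"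

end

theory Submission
  imports Defs
begin

text \<open>
  The conjugate-linear operator \<open>L h = \<Sum>\<^sub>i \<langle>f\<^sub>i, h\<rangle> v\<^sub>i\<close> maps \<open>u\<^sub>j\<close> to \<open>w\<^sub>j\<close>, and the matrix equation says
  that \<open>\<langle>L h, v\<^sub>i\<rangle> = \<langle>f\<^sub>i, h\<rangle>\<close> for all \<open>i\<close>. Since the analysis operator \<open>V\<close> of \<open>v\<close> is isometric, \<open>L\<close> is
  bounded below, its range is the closed span of \<open>w\<close>, and \<open>S\<^sub>w L = L S\<^sub>f\<close>. Hence \<open>y\<^sub>i = L S\<^sub>f\<^sup>-\<^sup>1 f\<^sub>i\<close>, and
  the kernel of \<open>T\<^sub>y\<close> is the orthogonal complement of the range of \<open>V L\<close>. It contains both the image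
  under \<open>V\<close> of the orthogonal complement of \<open>w\<close> and the orthogonal complement of the range of \<open>V\<close>;
  the latter is nonzero because \<open>v\<close> is not an orthonormal basis.
\<close>

section \<open>Complex inner products\<close>

instance chilbert \<subseteq> banach ..

lemma cinner_add_right: "cinner x (y + z) = cinner x y + cinner x z"
  by (metis cinner_add_left cinner_commute complex_cnj_add)

lemma cinner_scaleC_right: "cinner x (a *\<^sub>C y) = cnj a * cinner x y"
  by (metis cinner_scaleC_left cinner_commute complex_cnj_mult)

lemma cinner_scaleR_left: "cinner (r *\<^sub>R x) y = complex_of_real r * cinner x y"
  by (simp add: scaleR_scaleC cinner_scaleC_left)

lemma cinner_scaleR_right: "cinner x (r *\<^sub>R y) = complex_of_real r * cinner x y"
  by (simp add: scaleR_scaleC cinner_scaleC_right)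

lemma cinner_zero_left [simp]: "cinner 0 y = 0"
  by (metis add_cancel_right_left cinner_add_left)

lemma cinner_zero_right [simp]: "cinner x 0 = 0"
  by (metis add_cancel_right_left cinner_add_right)

lemma cinner_diff_left: "cinner (x - y) z = cinner x z - cinner y z"
  by (metis add_diff_cancel cinner_add_left diff_add_cancel)

lemma cinner_sum_left: "cinner (sum f F) y = (\<Sum>i\<in>F. cinner (f i) y)"
  by (induction F rule: infinite_finite_induct) (simp_all add: cinner_add_left)

lemma cinner_sum_right: "cinner x (sum f F) = (\<Sum>i\<in>F. cinner x (f i))"
  by (induction F rule: infinite_finite_induct) (simp_all add: cinner_add_right)

lemma cinner_eq_zero_commute: "cinner x y = 0 \<longleftrightarrow> cinner y x = 0"
  by (metis cinner_commute complex_cnj_zero_iff)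

lemma cmod_cinner_commute: "cmod (cinner x y) = cmod (cinner y x)"
  by (metis cinner_commute complex_mod_cnj)

lemma cinner_self_eq_zero [simp]: "cinner x x = 0 \<longleftrightarrow> x = 0"
  by (simp add: cinner_self)

lemma cmod_cinner_self: "cmod (cinner x x) = (norm x)\<^sup>2"
  by (simp add: cinner_self norm_power)

lemma cinner_extI:
  assumes "\<And>z. cinner x z = cinner y z"
  shows "x = y"
proof -
  have "cinner (x - y) (x - y) = 0"
    by (simp add: cinner_diff_left assms)
  then show ?thesis by simp
qed

lemma norm_scaleC: "norm (a *\<^sub>C x) = cmod a * norm x"
proof -
  have "(norm (a *\<^sub>C x))\<^sup>2 = cmod (cinner (a *\<^sub>C x) (a *\<^sub>C x))"
    by (rule cmod_cinner_self[symmetric])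
  also have "\<dots> = cmod a * (cmod a * cmod (cinner x x))"
    by (simp only: cinner_scaleC_left cinner_scaleC_right norm_mult complex_mod_cnj)
  also have "\<dots> = (cmod a * norm x)\<^sup>2"
    by (simp only: cmod_cinner_self power2_eq_square mult_ac)
  finally show ?thesis
    by (simp add: power2_eq_iff_nonneg)
qed

lemma cmod_cinner_le: "cmod (cinner x y) \<le> norm x * norm y"
proof (cases "cinner x y = 0")
  case False
  \<comment> \<open>A unimodular factor rotating the inner product onto the positive reals, where
    the real Cauchy-Schwarz inequality applies.\<close>
  define a where "a = cnj (sgn (cinner x y))"
  have "cmod a = 1"
    using False by (simp add: a_def norm_sgn)
  have "cinner (a *\<^sub>C x) y = complex_of_real (cmod (cinner x y))"
    unfolding cinner_scaleC_left a_def sgn_eq complex_cnj_divide complex_cnj_complex_of_real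
    using False complex_norm_square[of "cinner x y"]
    by (simp add: divide_simps power2_eq_square mult.commute)
  then have "cmod (cinner x y) = inner (a *\<^sub>C x) y"
    by (simp add: inner_eq_Re_cinner)
  also have "\<dots> \<le> norm (a *\<^sub>C x) * norm y"
    by (rule norm_cauchy_schwarz)
  finally show ?thesis
    by (simp add: norm_scaleC \<open>cmod a = 1\<close>)
qed simp

lemma bounded_linear_cinner_left: "bounded_linear (\<lambda>x. cinner x y)"
  by (rule bounded_linear_intro[where K = "norm y"])
    (simp_all add: cinner_add_left cinner_scaleR_left scaleR_conv_of_real cmod_cinner_le)

lemma bounded_linear_cinner_right: "bounded_linear (cinner x)"
  by (rule bounded_linear_intro[where K = "norm x"])
    (use cmod_cinner_le[of x] in \<open>simp_all add: cinner_add_right cinner_scaleR_right scaleR_conv_of_real mult.commute\<close>)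

lemmas has_sum_cinner_left = has_sum_bounded_linear[OF bounded_linear_cinner_left]
lemmas has_sum_cinner_right = has_sum_bounded_linear[OF bounded_linear_cinner_right]
lemmas continuous_on_cinner_left [continuous_intros] =
  bounded_linear.continuous_on[OF bounded_linear_cinner_left]

text \<open>The real parts agree by the real polarization identity \<open>dot_norm\<close>;
  replacing \<open>y\<close> by \<open>\<i> *\<^sub>C y\<close> turns the imaginary part into a real
  part.\<close>

lemma polarization_cinner:
  fixes T :: "'a::complex_inner \<Rightarrow> 'b::complex_inner"
  assumes "\<And>x y. T (x + y) = T x + T y" "\<And>a x. T (a *\<^sub>C x) = a *\<^sub>C T x"
    and "\<And>x. norm (T x) = norm x"
  shows "cinner (T x) (T y) = cinner x y"
proof -
  have Re: "Re (cinner (T x) (T y)) = Re (cinner x y)" for x y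
    unfolding inner_eq_Re_cinner[symmetric] dot_norm assms(1)[symmetric] assms(3) ..
  have "Im (cinner (T x) (T y)) = Re (cinner (T x) (T (\<i> *\<^sub>C y)))"
    by (simp add: assms(2) cinner_scaleC_right)
  also have "\<dots> = Im (cinner x y)"
    unfolding Re by (simp add: cinner_scaleC_right)
  finally show ?thesis
    by (simp add: Re complex_eq_iff)
qed

lemma cspan_induct [consumes 1, case_names zero add scale base]:
  assumes "x \<in> cspan S" and "P 0" and "\<And>x y. P x \<Longrightarrow> P y \<Longrightarrow> P (x + y)"
    and "\<And>a x. P x \<Longrightarrow> P (a *\<^sub>C x)" and "\<And>x. x \<in> S \<Longrightarrow> P x"
  shows "P x"
  using assms(1)
proof (rule complex_vector.span_induct)
  show "complex_vector.subspace {x. P x}"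
    unfolding complex_vector.subspace_def using assms by auto
qed (use assms in auto)

text \<open>Vanishing spreads from generators to the span by linearity and to its closure by
  continuity.\<close>

lemma cinner_closure_cspan_eq_0:
  assumes "x \<in> closure (cspan S)" and "\<And>z. z \<in> S \<Longrightarrow> cinner z y = 0"
  shows "cinner x y = 0"
proof -
  have "cinner z y = 0" if "z \<in> cspan S" for z
    using that by (induction rule: cspan_induct) (simp_all add: cinner_add_left cinner_scaleC_left assms)
  then show ?thesis
    using continuous_constant_on_closure[of "cspan S" "\<lambda>x. cinner x y" 0 x] assms(1)
    by (simp add: continuous_on_cinner_left)
qed

lemma has_sum_in_closure_cspan:
  assumes "((\<lambda>i. c i *\<^sub>C g i) has_sum s) A" "\<And>i. i \<in> A \<Longrightarrow> g i \<in> S"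
  shows "s \<in> closure (cspan S)"
proof (rule Lim_in_closed_set)
  show "(sum (\<lambda>i. c i *\<^sub>C g i) \<longlongrightarrow> s) (finite_subsets_at_top A)"
    using assms(1) by (simp add: has_sum_def)
  show "\<forall>\<^sub>F F in finite_subsets_at_top A. sum (\<lambda>i. c i *\<^sub>C g i) F \<in> closure (cspan S)"
  proof (rule eventually_finite_subsets_at_top_weakI)
    fix F
    assume "F \<subseteq> A"
    then have "sum (\<lambda>i. c i *\<^sub>C g i) F \<in> cspan S"
      using assms(2) by (intro complex_vector.span_sum complex_vector.span_scale complex_vector.span_base) blast
    then show "sum (\<lambda>i. c i *\<^sub>C g i) F \<in> closure (cspan S)"
      using closure_subset by blast
  qed
qed auto

section \<open>Completeness of the space of square summable families\<close>

lemma has_sum_norm_ell2: "((\<lambda>i. (cmod (ell2_coeff c i))\<^sup>2) has_sum (norm c)\<^sup>2) UNIV"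
proof -
  have "((\<lambda>i. ell2_coeff c i * cnj (ell2_coeff c i)) has_sum cinner c c) UNIV"
    unfolding cinner_ell2_def by (rule has_sum_infsum[OF ell2_summable_cinner])
  from has_sum_Re[OF this] show ?thesis
    unfolding cinner_self complex_norm_square[symmetric] Re_complex_of_real .
qed

lemma has_sum_cinner_ell2:
  "((\<lambda>i. ell2_coeff c i * cnj (ell2_coeff d i)) has_sum cinner c d) UNIV"
  unfolding cinner_ell2_def by (rule has_sum_infsum[OF ell2_summable_cinner])

lemma sum_ell2_coeff_le: "finite F \<Longrightarrow> (\<Sum>i\<in>F. (cmod (ell2_coeff c i))\<^sup>2) \<le> (norm c)\<^sup>2"
  by (rule finite_sum_le_has_sum[OF has_sum_norm_ell2]) auto

lemma cmod_ell2_coeff_le: "cmod (ell2_coeff c i) \<le> norm c"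
  by (rule power2_le_imp_le) (use sum_ell2_coeff_le[of "{i}" c] in simp_all)

lemma ell2_coeff_diff: "ell2_coeff (c - d) i = ell2_coeff c i - ell2_coeff d i"
  unfolding minus_ell2_def uminus_ell2_def plus_ell2.rep_eq scaleC_ell2.rep_eq by simp

lemma ell2_eqI: "(\<And>i. ell2_coeff c i = ell2_coeff d i) \<Longrightarrow> c = d"
  by (rule ell2_coeff_inject[THEN iffD1]) (rule ext)

text \<open>Completeness lets the dimension theory below apply to kernels of synthesis operators.
  The limit is built coordinatewise.\<close>

instance ell2 :: (type) chilbert
proof
  fix X :: "nat \<Rightarrow> 'a ell2"
  assume X: "Cauchy X"
  have "Cauchy (\<lambda>n. ell2_coeff (X n) i)" for i
  proof (rule CauchyI)
    fix e :: real
    assume "e > 0"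
    then obtain M where "\<forall>m\<ge>M. \<forall>n\<ge>M. norm (X m - X n) < e"
      using CauchyD[OF X] by blast
    then have "\<forall>m\<ge>M. \<forall>n\<ge>M. norm (ell2_coeff (X m) i - ell2_coeff (X n) i) < e"
      by (metis cmod_ell2_coeff_le ell2_coeff_diff order_le_less_trans)
    then show "\<exists>M. \<forall>m\<ge>M. \<forall>n\<ge>M. norm (ell2_coeff (X m) i - ell2_coeff (X n) i) < e" ..
  qed
  then have "\<exists>l. (\<lambda>n. ell2_coeff (X n) i) \<longlonglongrightarrow> l" for i
    by (simp add: Cauchy_convergent_iff convergent_def)
  then obtain l where l: "(\<lambda>n. ell2_coeff (X n) i) \<longlonglongrightarrow> l i" for i
    by metis
  \<comment> \<open>An eventual norm bound passes to finite sections of the coordinatewise limit.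
    With \<open>d = 0\<close> this gives square summability of \<open>l\<close>; with
    \<open>d\<close> a late term of \<open>X\<close> it gives norm convergence.\<close>
  have fin: "(\<Sum>i\<in>F. (cmod (l i - ell2_coeff d i))\<^sup>2) \<le> K\<^sup>2"
    if "finite F" "\<forall>n\<ge>M. norm (X n - d) \<le> K" for F d M K
  proof (rule tendsto_upperbound)
    show "(\<lambda>n. \<Sum>i\<in>F. (cmod (ell2_coeff (X n) i - ell2_coeff d i))\<^sup>2)
        \<longlonglongrightarrow> (\<Sum>i\<in>F. (cmod (l i - ell2_coeff d i))\<^sup>2)"
      by (intro tendsto_intros l)
    have "(\<Sum>i\<in>F. (cmod (ell2_coeff (X n) i - ell2_coeff d i))\<^sup>2) \<le> K\<^sup>2" if "n \<ge> M" for n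
    proof -
      have "(\<Sum>i\<in>F. (cmod (ell2_coeff (X n) i - ell2_coeff d i))\<^sup>2) \<le> (norm (X n - d))\<^sup>2"
        using sum_ell2_coeff_le[OF \<open>finite F\<close>, of "X n - d"] by (simp add: ell2_coeff_diff)
      also have "\<dots> \<le> K\<^sup>2"
        using \<open>\<forall>n\<ge>M. norm (X n - d) \<le> K\<close> that by (simp add: power_mono)
      finally show ?thesis .
    qed
    then show "\<forall>\<^sub>F n in sequentially. (\<Sum>i\<in>F. (cmod (ell2_coeff (X n) i - ell2_coeff d i))\<^sup>2) \<le> K\<^sup>2"
      using eventually_sequentially by auto
  qed simp
  obtain K where "\<forall>n. norm (X n) \<le> K"
    using Cauchy_Bseq[OF X] by (auto simp: Bseq_def)
  then have K: "\<forall>n\<ge>0. norm (X n - 0) \<le> K"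
    by simp
  have "(\<lambda>i. (cmod (l i))\<^sup>2) summable_on UNIV"
  proof (rule nonneg_bdd_above_summable_on)
    show "bdd_above (sum (\<lambda>i. (cmod (l i))\<^sup>2) ` {F. F \<subseteq> UNIV \<and> finite F})"
      using fin[OF _ K] by (intro bdd_aboveI[of _ "K\<^sup>2"]) (auto simp: zero_ell2.rep_eq)
  qed simp
  then obtain c where c: "ell2_coeff c = l"
    using Abs_ell2_inverse[of l] by auto
  have "X \<longlonglongrightarrow> c"
  proof (rule LIMSEQ_I)
    fix e :: real
    assume "e > 0"
    \<comment> \<open>Halving \<open>e\<close> turns the nonstrict bound inherited by the limit into
      a strict one.\<close>
    then obtain M where M: "\<forall>m\<ge>M. \<forall>n\<ge>M. norm (X m - X n) < e / 2"
      using CauchyD[OF X, of "e / 2"] by auto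
    have "norm (X n - c) < e" if "n \<ge> M" for n
    proof -
      have "\<forall>m\<ge>M. norm (X m - X n) \<le> e / 2"
        using M that less_imp_le by blast
      then have "(\<Sum>i\<in>F. (cmod (ell2_coeff (c - X n) i))\<^sup>2) \<le> (e / 2)\<^sup>2" if "finite F" for F
        unfolding ell2_coeff_diff c using that by (intro fin)
      then have "(norm (c - X n))\<^sup>2 \<le> (e / 2)\<^sup>2"
        by (rule has_sum_le_finite_sums[OF has_sum_norm_ell2])
      then have "norm (c - X n) \<le> e / 2"
        by (rule power2_le_imp_le) (use \<open>e > 0\<close> in simp)
      also have "\<dots> < e"
        using \<open>e > 0\<close> by simp
      finally show ?thesis
        by (subst norm_minus_commute)
    qed
    then show "\<exists>M. \<forall>n\<ge>M. norm (X n - c) < e" by metis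
  qed
  then show "convergent X" by (rule convergentI)
qed

definition unit_ell2 :: "'i \<Rightarrow> 'i ell2"
  where "unit_ell2 i = Abs_ell2 (\<lambda>j. of_bool (j = i))"

lemma ell2_coeff_unit_ell2: "ell2_coeff (unit_ell2 i) j = of_bool (j = i)"
proof -
  have "(\<lambda>j. (cmod (of_bool (j = i)))\<^sup>2) summable_on UNIV"
    by (rule finite_nonzero_values_imp_summable_on) simp
  then show ?thesis
    by (simp add: unit_ell2_def Abs_ell2_inverse)
qed

lemma cinner_unit_ell2: "cinner (unit_ell2 i) d = cnj (ell2_coeff d i)"
proof -
  have "((\<lambda>j. ell2_coeff (unit_ell2 i) j * cnj (ell2_coeff d j)) has_sum cnj (ell2_coeff d i)) UNIV"
    by (rule has_sum_finite_neutralI[of "{i}"]) (auto simp: ell2_coeff_unit_ell2)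
  with has_sum_cinner_ell2 show ?thesis
    by (rule has_sum_unique)
qed

section \<open>Bessel sequences\<close>

text \<open>The upper frame bound alone. The sign condition keeps the estimates with
  \<open>sqrt B\<close> meaningful even on the zero space, where the inequality itself does not
  constrain \<open>B\<close>.\<close>

definition bessel :: "('i \<Rightarrow> 'a::complex_inner) \<Rightarrow> real \<Rightarrow> bool"
  where "bessel f B \<longleftrightarrow> 0 \<le> B \<and>
    (\<forall>x. (\<lambda>i. (cmod (cinner x (f i)))\<^sup>2) summable_on UNIV \<and>
      (\<Sum>\<^sub>\<infinity>i. (cmod (cinner x (f i)))\<^sup>2) \<le> B * (norm x)\<^sup>2)"

text \<open>\<open>Abs_ell2\<close> is only meaningful on square summable coefficients, hence the
  Bessel hypotheses below.\<close>

definition analysis :: "('i \<Rightarrow> 'a::complex_inner) \<Rightarrow> 'a \<Rightarrow> 'i ell2"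
  where "analysis f x = Abs_ell2 (\<lambda>i. cinner x (f i))"

text \<open>Absorbs the conjugate-linearity of \<open>L\<close>, whose coefficients are conjugate to
  those of \<open>analysis f\<close>.\<close>

lift_definition cnj_ell2 :: "'i ell2 \<Rightarrow> 'i ell2" is "\<lambda>c i. cnj (c i)"
  by simp

lemma cnj_cnj_ell2 [simp]: "cnj_ell2 (cnj_ell2 c) = c"
  by transfer simp

lemma cnj_ell2_add: "cnj_ell2 (c + d) = cnj_ell2 c + cnj_ell2 d"
  by transfer simp

lemma cnj_ell2_scaleC: "cnj_ell2 (a *\<^sub>C c) = cnj a *\<^sub>C cnj_ell2 c"
  by transfer simp

lemma cinner_cnj_ell2: "cinner (cnj_ell2 c) d = cnj (cinner c (cnj_ell2 d))"
proof -
  have "((\<lambda>i. cnj (ell2_coeff c i * cnj (ell2_coeff (cnj_ell2 d) i))) has_sum cnj (cinner c (cnj_ell2 d))) UNIV"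
    using has_sum_cinner_ell2 by (simp only: has_sum_cnj_iff)
  with has_sum_cinner_ell2[of "cnj_ell2 c" d] show ?thesis
    by (simp add: cnj_ell2.rep_eq has_sum_unique)
qed

lemma norm_cnj_ell2: "norm (cnj_ell2 c) = norm c"
proof (rule power2_eq_imp_eq)
  show "(norm (cnj_ell2 c))\<^sup>2 = (norm c)\<^sup>2"
    unfolding cmod_cinner_self[symmetric] by (simp add: cinner_cnj_ell2)
qed simp_all

lemma besselI_finite:
  assumes "\<And>x F. finite F \<Longrightarrow> (\<Sum>i\<in>F. (cmod (cinner x (f i)))\<^sup>2) \<le> B * (norm x)\<^sup>2" and "0 \<le> B"
  shows "bessel f B"
proof -
  have "(\<lambda>i. (cmod (cinner x (f i)))\<^sup>2) summable_on UNIV" for x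
    using assms(1) by (intro nonneg_bdd_above_summable_on bdd_aboveI[of _ "B * (norm x)\<^sup>2"]) auto
  then show ?thesis
    unfolding bessel_def using assms by (auto intro: infsum_le_finite_sums)
qed

lemma ell2_coeff_analysis: "bessel f B \<Longrightarrow> ell2_coeff (analysis f x) i = cinner x (f i)"
  by (simp add: analysis_def bessel_def Abs_ell2_inverse)

lemma norm_analysis: "bessel f B \<Longrightarrow> (norm (analysis f x))\<^sup>2 = (\<Sum>\<^sub>\<infinity>i. (cmod (cinner x (f i)))\<^sup>2)"
  using has_sum_norm_ell2[of "analysis f x"] by (simp add: ell2_coeff_analysis infsumI)

lemma norm_analysis_le:
  assumes "bessel f B"
  shows "norm (analysis f x) \<le> sqrt B * norm x"
proof (rule power2_le_imp_le)
  show "(norm (analysis f x))\<^sup>2 \<le> (sqrt B * norm x)\<^sup>2"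
    using assms unfolding norm_analysis[OF assms] by (simp add: bessel_def power_mult_distrib)
  show "0 \<le> sqrt B * norm x"
    using assms by (simp add: bessel_def)
qed

lemma analysis_add: "bessel f B \<Longrightarrow> analysis f (x + y) = analysis f x + analysis f y"
  by (rule ell2_eqI) (simp add: ell2_coeff_analysis plus_ell2.rep_eq cinner_add_left)

lemma analysis_scaleC: "bessel f B \<Longrightarrow> analysis f (a *\<^sub>C x) = a *\<^sub>C analysis f x"
  by (rule ell2_eqI) (simp add: ell2_coeff_analysis scaleC_ell2.rep_eq cinner_scaleC_left)

text \<open>Pair the sum with itself, apply Cauchy-Schwarz to the coefficients and the Bessel bound
  to the sum, then cancel its squared norm.\<close>

lemma norm_sum_bessel_le:
  assumes "bessel f B" "finite F"
  shows "(norm (\<Sum>i\<in>F. c i *\<^sub>C f i))\<^sup>2 \<le> B * (\<Sum>i\<in>F. (cmod (c i))\<^sup>2)"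
proof -
  let ?s = "\<Sum>i\<in>F. c i *\<^sub>C f i"
  have "(\<Sum>i\<in>F. (cmod (cinner ?s (f i)))\<^sup>2) \<le> (\<Sum>\<^sub>\<infinity>i. (cmod (cinner ?s (f i)))\<^sup>2)"
    using assms by (intro finite_sum_le_infsum) (auto simp: bessel_def)
  also have "\<dots> \<le> B * (norm ?s)\<^sup>2"
    using assms by (simp add: bessel_def)
  finally have le: "(\<Sum>i\<in>F. (cmod (cinner ?s (f i)))\<^sup>2) \<le> B * (norm ?s)\<^sup>2" .
  have "(norm ?s)\<^sup>2 = cmod (\<Sum>i\<in>F. cinner (c i *\<^sub>C f i) ?s)"
    unfolding cinner_sum_left[symmetric] by (rule cmod_cinner_self[symmetric])
  also have "\<dots> \<le> (\<Sum>i\<in>F. cmod (c i) * cmod (cinner ?s (f i)))"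
    by (rule order_trans[OF norm_sum])
      (simp add: cinner_scaleC_left norm_mult cmod_cinner_commute[of "f _"])
  finally have "((norm ?s)\<^sup>2)\<^sup>2 \<le> (\<Sum>i\<in>F. cmod (c i) * cmod (cinner ?s (f i)))\<^sup>2"
    by (rule power_mono) simp
  also have "\<dots> \<le> (\<Sum>i\<in>F. (cmod (c i))\<^sup>2) * (\<Sum>i\<in>F. (cmod (cinner ?s (f i)))\<^sup>2)"
    by (rule Cauchy_Schwarz_ineq_sum)
  also have "\<dots> \<le> (\<Sum>i\<in>F. (cmod (c i))\<^sup>2) * (B * (norm ?s)\<^sup>2)"
    using le by (intro mult_left_mono sum_nonneg) auto
  finally have *: "(norm ?s)\<^sup>2 * (norm ?s)\<^sup>2 \<le> (B * (\<Sum>i\<in>F. (cmod (c i))\<^sup>2)) * (norm ?s)\<^sup>2"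
    by (simp add: power2_eq_square[of "(norm ?s)\<^sup>2"] mult_ac)
  show ?thesis
  proof (cases "?s = 0")
    case True
    then show ?thesis
      using assms(1) by (simp add: bessel_def sum_nonneg)
  next
    case False
    then show ?thesis
      using mult_right_le_imp_le[OF *] by simp
  qed
qed

text \<open>A Cauchy criterion for unordered sums: blocks outside a large finite set have small norm
  because they carry little of the sum of \<open>h\<close>.\<close>

lemma summable_on_if_norm_sum_le:
  fixes g :: "'i \<Rightarrow> 'a::banach" and h :: "'i \<Rightarrow> real"
  assumes h: "h summable_on A"
    and le: "\<And>F. finite F \<Longrightarrow> F \<subseteq> A \<Longrightarrow> (norm (sum g F))\<^sup>2 \<le> B * sum h F" and "0 \<le> B"
  shows "g summable_on A"
proof -
  have "\<exists>P. eventually P (finite_subsets_at_top A) \<and>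
      (\<forall>F F'. P F \<and> P F' \<longrightarrow> dist (sum g F) (sum g F') < e)" if "e > 0" for e
  proof -
    \<comment> \<open>Chosen so that \<open>B * d\<close> stays below the square of
      \<open>e / 2\<close>; the summand 1 keeps the denominator positive when
      \<open>B = 0\<close>.\<close>
    define d where "d = (e / 2)\<^sup>2 / (B + 1)"
    have "d > 0"
      using that \<open>0 \<le> B\<close> by (simp add: d_def)
    have "B * d < (e / 2)\<^sup>2"
      using that \<open>0 \<le> B\<close> by (simp add: d_def field_simps)
    obtain F0 where F0: "finite F0" "F0 \<subseteq> A"
      and close: "\<And>F. finite F \<Longrightarrow> F0 \<subseteq> F \<Longrightarrow> F \<subseteq> A \<Longrightarrow> dist (sum h F) (infsum h A) < d / 2"
      using tendstoD[OF has_sum_infsum[OF h, unfolded has_sum_def], of "d / 2"] \<open>d > 0\<close>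
      unfolding eventually_finite_subsets_at_top by auto
    have near: "dist (sum g F) (sum g F0) < e / 2" if F: "finite F" "F0 \<subseteq> F" "F \<subseteq> A" for F
    proof (rule power2_less_imp_less)
      have "(dist (sum g F) (sum g F0))\<^sup>2 = (norm (sum g (F - F0)))\<^sup>2"
        using F by (simp add: dist_norm sum_diff)
      also have "\<dots> \<le> B * sum h (F - F0)"
        using F by (intro le) auto
      also have "sum h (F - F0) = sum h F - sum h F0"
        using F by (simp add: sum_diff)
      also have "B * (sum h F - sum h F0) \<le> B * d"
      proof (rule mult_left_mono[OF _ \<open>0 \<le> B\<close>])
        show "sum h F - sum h F0 \<le> d"
          using close[OF F] close[OF F0(1) order_refl F0(2)] unfolding dist_real_def by linarith
      qed
      also note \<open>B * d < (e / 2)\<^sup>2\<close>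
      finally show "(dist (sum g F) (sum g F0))\<^sup>2 < (e / 2)\<^sup>2" .
    qed (use \<open>e > 0\<close> in simp)
    let ?P = "\<lambda>F. finite F \<and> F0 \<subseteq> F \<and> F \<subseteq> A"
    have "eventually ?P (finite_subsets_at_top A)"
      using F0 by (auto simp: eventually_finite_subsets_at_top)
    moreover have "dist (sum g F) (sum g F') < e" if "?P F \<and> ?P F'" for F F'
      using dist_triangle_half_l[OF near near] that by blast
    ultimately show ?thesis
      by blast
  qed
  then have "cauchy_filter (filtermap (sum g) (finite_subsets_at_top A))"
    by (simp add: cauchy_filter_metric_filtermap)
  then obtain l where "(sum g \<longlongrightarrow> l) (finite_subsets_at_top A)"
    using complete_uniform[where S = "UNIV :: 'a set"] complete_UNIV by (force simp: filterlim_def)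
  then show ?thesis
    by (auto simp: summable_on_def has_sum_def)
qed

lemma has_sum_synthesis:
  fixes f :: "'i \<Rightarrow> 'a::chilbert"
  assumes "bessel f B"
  shows "((\<lambda>i. ell2_coeff c i *\<^sub>C f i) has_sum synthesis f c) UNIV"
  unfolding synthesis_def
proof (rule has_sum_infsum, rule summable_on_if_norm_sum_le)
  show "(\<lambda>i. (cmod (ell2_coeff c i))\<^sup>2) summable_on UNIV"
    by (rule ell2_coeff_square_summable)
  show "0 \<le> B"
    using assms by (simp add: bessel_def)
qed (rule norm_sum_bessel_le[OF assms])

text \<open>Synthesis is the adjoint of analysis. With \<open>cinner_extI\<close> this reduces
  identities for synthesis to identities for analysis.\<close>

lemma cinner_synthesis:
  fixes f :: "'i \<Rightarrow> 'a::chilbert"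
  assumes "bessel f B"
  shows "cinner (synthesis f c) x = cinner c (analysis f x)"
proof -
  have "cinner (ell2_coeff c i *\<^sub>C f i) x = ell2_coeff c i * cnj (ell2_coeff (analysis f x) i)" for i
    unfolding cinner_scaleC_left ell2_coeff_analysis[OF assms] cinner_commute[of "f i" x] ..
  with has_sum_cinner_left[OF has_sum_synthesis[OF assms], of c x]
  have "((\<lambda>i. ell2_coeff c i * cnj (ell2_coeff (analysis f x) i)) has_sum cinner (synthesis f c) x) UNIV"
    by simp
  then show ?thesis
    using has_sum_cinner_ell2 by (rule has_sum_unique)
qed

lemma norm_synthesis_le:
  fixes f :: "'i \<Rightarrow> 'a::chilbert"
  assumes "bessel f B"
  shows "norm (synthesis f c) \<le> sqrt B * norm c"
proof -
  let ?s = "synthesis f c"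
  have "norm ?s * norm ?s = cmod (cinner c (analysis f ?s))"
    by (simp add: cmod_cinner_self power2_eq_square flip: cinner_synthesis[OF assms])
  also have "\<dots> \<le> norm c * (sqrt B * norm ?s)"
    by (rule order_trans[OF cmod_cinner_le]) (simp add: mult_left_mono norm_analysis_le[OF assms])
  finally have *: "norm ?s * norm ?s \<le> (sqrt B * norm c) * norm ?s"
    by (simp add: mult_ac)
  show ?thesis
  proof (cases "?s = 0")
    case True
    then show ?thesis
      using assms by (simp add: bessel_def)
  next
    case False
    then show ?thesis
      using mult_right_le_imp_le[OF *] by simp
  qed
qed

lemma synthesis_add:
  fixes f :: "'i \<Rightarrow> 'a::chilbert"
  shows "bessel f B \<Longrightarrow> synthesis f (c + d) = synthesis f c + synthesis f d"
  by (rule cinner_extI) (simp add: cinner_synthesis cinner_add_left)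

lemma synthesis_scaleC:
  fixes f :: "'i \<Rightarrow> 'a::chilbert"
  shows "bessel f B \<Longrightarrow> synthesis f (a *\<^sub>C c) = a *\<^sub>C synthesis f c"
  by (rule cinner_extI) (simp add: cinner_synthesis cinner_scaleC_left)

section \<open>Orthonormal bases and dimension\<close>

text \<open>The orthonormality half of \<open>is_onb_on\<close> for a set indexed by itself, the
  form in which \<open>hdim\<close> counts bases.\<close>

definition orthonormal :: "'a::complex_inner set \<Rightarrow> bool"
  where "orthonormal B \<longleftrightarrow> (\<forall>x\<in>B. \<forall>y\<in>B. cinner x y = of_bool (x = y))"

lemma orthonormal_subset: "orthonormal B \<Longrightarrow> C \<subseteq> B \<Longrightarrow> orthonormal C"
  unfolding orthonormal_def by blast

lemma orthonormal_insert:
  assumes "orthonormal B" "norm q = 1" "\<And>b. b \<in> B \<Longrightarrow> cinner q b = 0"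
  shows "q \<notin> B" "orthonormal (insert q B)"
proof -
  have "cinner q q = 1"
    using assms(2) by (simp add: cinner_self)
  then show "q \<notin> B"
    using assms(3) by force
  have "cinner b q = 0" if "b \<in> B" for b
    using assms(3)[OF that] by (simp add: cinner_eq_zero_commute[of b])
  with \<open>q \<notin> B\<close> \<open>cinner q q = 1\<close> assms(1,3) show "orthonormal (insert q B)"
    unfolding orthonormal_def by auto
qed

lemma cinner_sum_orthonormal:
  assumes "orthonormal F" "finite F" "b \<in> F"
  shows "cinner (\<Sum>e\<in>F. a e *\<^sub>C e) b = a b"
proof -
  have "cinner (\<Sum>e\<in>F. a e *\<^sub>C e) b = (\<Sum>e\<in>F. if e = b then a e else 0)"
    unfolding cinner_sum_left
    using assms by (intro sum.cong) (auto simp: orthonormal_def cinner_scaleC_left)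
  then show ?thesis
    using assms by simp
qed

lemma norm_sum_orthonormal:
  assumes "orthonormal F" "finite F"
  shows "(norm (\<Sum>e\<in>F. a e *\<^sub>C e))\<^sup>2 = (\<Sum>e\<in>F. (cmod (a e))\<^sup>2)"
proof -
  let ?s = "\<Sum>e\<in>F. a e *\<^sub>C e"
  have "cinner ?s ?s = (\<Sum>e\<in>F. cinner ?s (a e *\<^sub>C e))"
    by (rule cinner_sum_right)
  also have "\<dots> = (\<Sum>e\<in>F. cnj (a e) * cinner ?s e)"
    by (simp only: cinner_scaleC_right)
  also have "\<dots> = (\<Sum>e\<in>F. complex_of_real ((cmod (a e))\<^sup>2))"
    using assms by (intro sum.cong refl)
      (simp only: cinner_sum_orthonormal complex_norm_square mult.commute)
  finally show ?thesis
    unfolding cinner_self of_real_sum[symmetric] of_real_eq_iff .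
qed

text \<open>Pythagoras: the residual is orthogonal to every vector of \<open>F\<close>, hence to the
  projection.\<close>

lemma orthonormal_residual:
  assumes "orthonormal F" "finite F"
  shows "(norm (x - (\<Sum>e\<in>F. cinner x e *\<^sub>C e)))\<^sup>2 = (norm x)\<^sup>2 - (\<Sum>e\<in>F. (cmod (cinner x e))\<^sup>2)"
proof -
  let ?s = "\<Sum>e\<in>F. cinner x e *\<^sub>C e"
  have orth: "cinner (x - ?s) e = 0" if "e \<in> F" for e
    using that assms by (simp add: cinner_diff_left cinner_sum_orthonormal)
  have "cinner (x - ?s) ?s = 0"
    unfolding cinner_sum_right by (rule sum.neutral) (simp add: cinner_scaleC_right orth)
  then have "orthogonal (x - ?s) ?s"
    by (simp add: orthogonal_def inner_eq_Re_cinner)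
  from norm_add_Pythagorean[OF this] show ?thesis
    using norm_sum_orthonormal[OF assms] by simp
qed

lemma bessel_inequality:
  assumes "orthonormal F" "finite F"
  shows "(\<Sum>e\<in>F. (cmod (cinner x e))\<^sup>2) \<le> (norm x)\<^sup>2"
  using orthonormal_residual[OF assms, of x] by (metis diff_ge_0_iff_ge zero_le_power2)


text \<open>The residual \<open>r\<close> vanishes on \<open>F\<close>, then on the span by
  linearity and on the closure by continuity; pairing with a fixed \<open>y\<close> makes this a
  statement about scalars.\<close>

lemma parseval_finite_onb:
  assumes "orthonormal F" "finite F" "x \<in> closure (cspan F)"
  shows "(\<Sum>e\<in>F. (cmod (cinner x e))\<^sup>2) = (norm x)\<^sup>2"
proof -
  define r where "r z = z - (\<Sum>e\<in>F. cinner z e *\<^sub>C e)" for z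
  have "cinner (r x) y = 0" for y
  proof -
    have "cinner (r z) y = 0" if "z \<in> cspan F" for z
      using that
    proof (induction rule: cspan_induct)
      case (base z)
      have "(\<Sum>e\<in>F. cinner z e *\<^sub>C e) = (\<Sum>e\<in>F. if e = z then e else 0)"
        using assms(1) base by (intro sum.cong) (auto simp: orthonormal_def scaleC_one)
      then show ?case
        using base assms(2) by (simp add: r_def)
    qed (simp_all add: r_def cinner_diff_left cinner_sum_left cinner_add_left cinner_scaleC_left
        sum.distrib sum_distrib_left algebra_simps)
    moreover have "continuous_on (closure (cspan F)) (\<lambda>z. cinner (r z) y)"
      unfolding r_def cinner_diff_left cinner_sum_left cinner_scaleC_left
      by (intro continuous_intros)
    ultimately show ?thesis
      using continuous_constant_on_closure[of "cspan F" "\<lambda>z. cinner (r z) y" 0 x] assms(3) by blast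
  qed
  then have "r x = 0"
    by (metis cinner_self_eq_zero)
  then show ?thesis
    using orthonormal_residual[OF assms(1,2), of x] by (simp add: r_def)
qed

text \<open>Double counting of the squared moduli of all inner products: Parseval over
  \<open>E\<close> gives exactly 1 for each vector of \<open>F\<close>, Bessel over \<open>F\<close>
  at most 1 for each vector of \<open>E\<close>.\<close>

lemma card_orthonormal_le:
  assumes E: "orthonormal E" "finite E" and B: "orthonormal B" "B \<subseteq> closure (cspan E)"
  shows "finite B \<and> card B \<le> card E"
proof -
  have "card F \<le> card E" if F: "finite F" "F \<subseteq> B" for F
  proof -
    have "orthonormal F"
      using B(1) F(2) by (rule orthonormal_subset)
    have norm_1: "(norm e)\<^sup>2 = 1" if "e \<in> C" "orthonormal C" for e :: 'a and C
      using that cmod_cinner_self[of e] by (simp add: orthonormal_def)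
    have "real (card F) = (\<Sum>b\<in>F. \<Sum>e\<in>E. (cmod (cinner b e))\<^sup>2)"
      using parseval_finite_onb[OF E] B F norm_1[OF _ B(1)] by (simp add: subset_iff)
    also have "\<dots> = (\<Sum>e\<in>E. \<Sum>b\<in>F. (cmod (cinner e b))\<^sup>2)"
      by (subst sum.swap) (simp add: cmod_cinner_commute)
    also have "\<dots> \<le> (\<Sum>e\<in>E. 1)"
      using bessel_inequality[OF \<open>orthonormal F\<close> F(1)] norm_1[OF _ E(1)]
      by (intro sum_mono) metis
    finally show ?thesis by simp
  qed
  then show ?thesis
    by (meson finite_if_finite_subsets_card_bdd order_refl)
qed

section \<open>Orthonormal bases of orthogonal complements\<close>

lemma ortho_complement_subspace: "complex_vector.subspace (ortho_complement S)"
  unfolding complex_vector.subspace_def ortho_complement_def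
  by (auto simp: cinner_add_left cinner_scaleC_left)

lemma closed_ortho_complement: "closed (ortho_complement S)"
proof -
  have "ortho_complement S = (\<Inter>y\<in>S. {x. cinner x y = 0})"
    by (auto simp: ortho_complement_def)
  also have "closed \<dots>"
    by (intro closed_INT ballI closed_Collect_eq continuous_intros)
  finally show ?thesis .
qed

text \<open>Synthesis sums over a whole index type, so the set is turned into a family indexed by
  all vectors, padded with zeros.\<close>

lemma bessel_orthonormal_family:
  fixes B :: "'a::complex_inner set"
  assumes "orthonormal B"
  shows "bessel (\<lambda>b. if b \<in> B then b else 0) 1"
proof (rule besselI_finite)
  fix x :: 'a and F :: "'a set"
  assume "finite F"
  have "(\<Sum>b\<in>F. (cmod (cinner x (if b \<in> B then b else 0)))\<^sup>2) = (\<Sum>b\<in>F \<inter> B. (cmod (cinner x b))\<^sup>2)"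
    using \<open>finite F\<close> by (intro sum.mono_neutral_cong_right) auto
  also have "\<dots> \<le> (norm x)\<^sup>2"
    using assms \<open>finite F\<close> by (intro bessel_inequality) (auto intro: orthonormal_subset)
  finally show "(\<Sum>b\<in>F. (cmod (cinner x (if b \<in> B then b else 0)))\<^sup>2) \<le> 1 * (norm x)\<^sup>2"
    by simp
qed simp

lemma maximal_orthonormal_onb:
  fixes S :: "'a::chilbert set"
  assumes B: "orthonormal B" "B \<subseteq> ortho_complement S"
    and max: "\<And>C. orthonormal C \<Longrightarrow> C \<subseteq> ortho_complement S \<Longrightarrow> B \<subseteq> C \<Longrightarrow> C = B"
  shows "is_onb_on B (\<lambda>x. x) (ortho_complement S)"
proof -
  let ?M = "ortho_complement S"
  have sub: "closure (cspan B) \<subseteq> ?M"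
    using closed_ortho_complement ortho_complement_subspace B(2)
    by (intro closure_minimal complex_vector.span_minimal)
  have "x \<in> closure (cspan B)" if "x \<in> ?M" for x
  proof -
    define g where "g b = (if b \<in> B then b else 0)" for b
    have g: "bessel g 1"
      unfolding g_def by (rule bessel_orthonormal_family[OF B(1)])
    \<comment> \<open>The orthogonal projection of \<open>x\<close> onto the closed span of
      \<open>B\<close>.\<close>
    define p where "p = synthesis g (analysis g x)"
    have p: "((\<lambda>b. cinner x (g b) *\<^sub>C g b) has_sum p) UNIV"
      using has_sum_synthesis[OF g, of "analysis g x"] by (simp add: p_def ell2_coeff_analysis[OF g])
    have "((\<lambda>b. cinner x b *\<^sub>C b) has_sum p) B"
      using p by (rule has_sum_cong_neutral[THEN iffD1, rotated -1]) (auto simp: g_def)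
    then have "p \<in> closure (cspan B)"
      by (rule has_sum_in_closure_cspan)
    have orth: "cinner (x - p) b = 0" if "b \<in> B" for b
    proof -
      have "((\<lambda>c. cinner (cinner x (g c) *\<^sub>C g c) b) has_sum cinner p b) UNIV"
        by (rule has_sum_cinner_left[OF p])
      also have "(\<lambda>c. cinner (cinner x (g c) *\<^sub>C g c) b) = (\<lambda>c. if c = b then cinner x b else 0)"
        using that B(1) by (auto simp: g_def orthonormal_def cinner_scaleC_left)
      finally have "cinner p b = cinner x b"
        by (rule has_sum_unique) (rule has_sum_finite_neutralI[of "{b}"], auto)
      then show ?thesis
        by (simp add: cinner_diff_left)
    qed
    have "x = p"
    proof (rule ccontr)
      assume "x \<noteq> p"
      \<comment> \<open>The normalized residual is orthogonal to \<open>B\<close> and lies in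
        \<open>?M\<close>, so adjoining it would contradict maximality.\<close>
      define q where "q = sgn (x - p)"
      have "norm q = 1"
        using \<open>x \<noteq> p\<close> by (simp add: q_def norm_sgn)
      have qB: "cinner q b = 0" if "b \<in> B" for b
        using orth[OF that] by (simp add: q_def sgn_div_norm cinner_scaleR_left)
      note q = orthonormal_insert[OF B(1) \<open>norm q = 1\<close> qB]
      have "q \<in> ?M"
        unfolding q_def sgn_div_norm scaleR_scaleC using that sub \<open>p \<in> _\<close>
        by (intro complex_vector.subspace_scale complex_vector.subspace_diff ortho_complement_subspace) auto
      then show False
        using max[of "insert q B"] B(2) q by blast
    qed
    then show ?thesis
      using \<open>p \<in> _\<close> by simp
  qed
  with sub B(1) show ?thesis
    unfolding is_onb_on_def orthonormal_def by auto
qed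

lemma onb_exists:
  fixes S :: "'a::chilbert set"
  shows "\<exists>E. is_onb_on E (\<lambda>x. x) (ortho_complement S)"
proof -
  define \<A> where "\<A> = {B. orthonormal B \<and> B \<subseteq> ortho_complement S}"
  have "\<exists>B\<in>\<A>. \<forall>C\<in>\<A>. B \<subseteq> C \<longrightarrow> C = B"
  proof (rule subset_Zorn')
    fix \<C>
    assume \<C>: "subset.chain \<A> \<C>"
    \<comment> \<open>Two vectors of the union already lie in a common member of the chain.\<close>
    have "cinner x y = of_bool (x = y)" if xy: "x \<in> \<Union>\<C>" "y \<in> \<Union>\<C>" for x y
    proof -
      from xy obtain B C where BC: "B \<in> \<C>" "C \<in> \<C>" "x \<in> B" "y \<in> C"
        by blast
      then have "B \<subseteq> C \<or> C \<subseteq> B"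
        using \<C> by (auto simp: subset.chain_def)
      then have "\<exists>D\<in>\<C>. x \<in> D \<and> y \<in> D"
        using BC by blast
      then obtain D where "D \<in> \<C>" "x \<in> D" "y \<in> D"
        by blast
      moreover have "orthonormal D"
        using \<C> \<open>D \<in> \<C>\<close> by (auto simp: subset.chain_def \<A>_def)
      ultimately show ?thesis
        by (simp add: orthonormal_def)
    qed
    then show "\<Union>\<C> \<in> \<A>"
      using \<C> by (auto simp: \<A>_def orthonormal_def subset.chain_def)
  qed
  then obtain B where "B \<in> \<A>" "\<And>C. C \<in> \<A> \<Longrightarrow> B \<subseteq> C \<Longrightarrow> C = B"
    by blast
  then have "is_onb_on B (\<lambda>x. x) (ortho_complement S)"
    by (intro maximal_orthonormal_onb) (auto simp: \<A>_def)
  then show ?thesis ..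
qed

text \<open>\<open>hdim\<close> selects its basis by \<open>SOME\<close>; only the existence of a
  basis guarantees that the selected set is one.\<close>

lemma hdim_ortho_complement:
  fixes S :: "'a::chilbert set"
  obtains E where "orthonormal E" "closure (cspan E) = ortho_complement S"
    and "hdim (ortho_complement S) = (if finite E then enat (card E) else \<infinity>)"
proof -
  define E where "E = (SOME E. is_onb_on E (\<lambda>x. x) (ortho_complement S))"
  have "is_onb_on E (\<lambda>x. x) (ortho_complement S)"
    unfolding E_def using onb_exists by (rule someI_ex)
  then have "orthonormal E" "closure (cspan E) = ortho_complement S"
    by (simp_all add: is_onb_on_def orthonormal_def)
  moreover have "hdim (ortho_complement S) = (if finite E then enat (card E) else \<infinity>)"
    unfolding hdim_def Let_def E_def ..
  ultimately show ?thesis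
    by (rule that)
qed

text \<open>The image under \<open>T\<close> of an orthonormal basis, enlarged by the normalized
  \<open>c\<close>, is orthonormal in the target. The extra vector makes the inequality strict in
  the finite case.\<close>

lemma hdim_isometric_embedding:
  fixes S :: "'a::chilbert set" and S' :: "'b::chilbert set" and T :: "'a \<Rightarrow> 'b"
  assumes T: "\<And>x y. cinner (T x) (T y) = cinner x y"
    and T_in: "\<And>x. x \<in> ortho_complement S \<Longrightarrow> T x \<in> ortho_complement S'"
    and c: "c \<in> ortho_complement S'" "c \<noteq> 0" "\<And>x. x \<in> ortho_complement S \<Longrightarrow> cinner c (T x) = 0"
  shows "hdim (ortho_complement S) \<le> hdim (ortho_complement S') \<and>
    (hdim (ortho_complement S) < \<infinity> \<longrightarrow> hdim (ortho_complement S) < hdim (ortho_complement S'))"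
proof -
  obtain E where E: "orthonormal E" "closure (cspan E) = ortho_complement S"
    and hdim_S: "hdim (ortho_complement S) = (if finite E then enat (card E) else \<infinity>)"
    by (rule hdim_ortho_complement)
  obtain E' where E': "orthonormal E'" "closure (cspan E') = ortho_complement S'"
    and hdim_S': "hdim (ortho_complement S') = (if finite E' then enat (card E') else \<infinity>)"
    by (rule hdim_ortho_complement)
  have E_sub: "E \<subseteq> ortho_complement S"
    using E(2) closure_subset complex_vector.span_superset by (metis order_trans)
  have "finite E \<and> card E < card E'" if "finite E'"
  proof -
    define d where "d = sgn c"
    have "norm d = 1"
      using c(2) by (simp add: d_def norm_sgn)
    have dT: "cinner d (T x) = 0" if "x \<in> E" for x
      using c(3) E_sub that by (auto simp: d_def sgn_div_norm cinner_scaleR_left)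
    have "inj_on T E"
    proof (rule inj_onI)
      fix x y
      assume "x \<in> E" "y \<in> E" "T x = T y"
      then show "x = y"
        using E(1) T[of x y] T[of x x] by (auto simp: orthonormal_def of_bool_def split: if_splits)
    qed
    then have "orthonormal (T ` E)"
      using E(1) by (auto simp: orthonormal_def T inj_on_eq_iff)
    note d = orthonormal_insert[OF this \<open>norm d = 1\<close>]
    have orth: "orthonormal (insert d (T ` E))" and "d \<notin> T ` E"
      using dT by (auto intro!: d)
    have sub: "insert d (T ` E) \<subseteq> closure (cspan E')"
      using E_sub T_in c(1) unfolding E'(2) d_def sgn_div_norm scaleR_scaleC
      by (auto intro: complex_vector.subspace_scale[OF ortho_complement_subspace])
    have "finite (insert d (T ` E)) \<and> card (insert d (T ` E)) \<le> card E'"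
      using E'(1) that orth sub by (rule card_orthonormal_le)
    with \<open>inj_on T E\<close> \<open>d \<notin> T ` E\<close> show ?thesis
      by (auto simp: finite_image_iff card_image)
  qed
  \<comment> \<open>For infinite \<open>E'\<close> the target dimension is
    \<open>\<infinity>\<close>, and both claims are immediate.\<close>
  then show ?thesis
    by (auto simp: hdim_S hdim_S')
qed

section \<open>Frames\<close>

lemma bessel_frame: "has_frame_bounds f UNIV A B \<Longrightarrow> 0 \<le> B \<Longrightarrow> bessel f B"
  by (simp add: has_frame_bounds_def bessel_def)

lemma bessel_parseval_frame: "is_parseval_frame u \<Longrightarrow> bessel u 1"
  unfolding is_parseval_frame_def by (erule bessel_frame) simp

lemma norm_analysis_frame_ge:
  assumes "has_frame_bounds f UNIV A B" "0 \<le> A" "0 \<le> B"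
  shows "sqrt A * norm x \<le> norm (analysis f x)"
proof (rule power2_le_imp_le)
  show "(sqrt A * norm x)\<^sup>2 \<le> (norm (analysis f x))\<^sup>2"
    using assms(1,2) unfolding norm_analysis[OF bessel_frame[OF assms(1,3)]]
    by (simp add: has_frame_bounds_def power_mult_distrib)
qed simp

text \<open>Both frame bounds being 1, analysis preserves norms, and polarization extends this to
  inner products.\<close>

lemma cinner_analysis_parseval:
  assumes "is_parseval_frame u"
  shows "cinner (analysis u x) (analysis u y) = cinner x y"
proof (rule polarization_cinner)
  note u = bessel_parseval_frame[OF assms]
  show "analysis u (x + y) = analysis u x + analysis u y" for x y
    by (rule analysis_add[OF u])
  show "analysis u (a *\<^sub>C x) = a *\<^sub>C analysis u x" for a x
    by (rule analysis_scaleC[OF u])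
  show "norm (analysis u x) = norm x" for x
    using norm_analysis_le[OF u, of x] norm_analysis_frame_ge[of u 1 1 x] assms
    by (simp add: is_parseval_frame_def)
qed

lemma synthesis_analysis_parseval:
  fixes u :: "'i \<Rightarrow> 'a::chilbert"
  assumes "is_parseval_frame u"
  shows "synthesis u (analysis u x) = x"
  by (rule cinner_extI)
    (simp add: cinner_synthesis[OF bessel_parseval_frame[OF assms]] cinner_analysis_parseval[OF assms])

lemma parseval_expansion:
  fixes u :: "'i \<Rightarrow> 'a::chilbert"
  assumes "is_parseval_frame u"
  shows "((\<lambda>j. cinner x (u j) *\<^sub>C u j) has_sum x) UNIV"
  using has_sum_synthesis[OF bessel_parseval_frame[OF assms], of "analysis u x"]
  by (simp add: synthesis_analysis_parseval[OF assms] ell2_coeff_analysis[OF bessel_parseval_frame[OF assms]])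

text \<open>Density of the span is automatic from the Parseval expansion. Contraposed, a Parseval
  frame that is not an orthonormal basis has a wrong Gram entry.\<close>

lemma parseval_frame_onbI:
  fixes v :: "'i \<Rightarrow> 'a::chilbert"
  assumes "is_parseval_frame v" and "\<And>i j. cinner (v i) (v j) = of_bool (i = j)"
  shows "is_onb_on UNIV v UNIV"
proof -
  have "x \<in> closure (cspan (range v))" for x
    using parseval_expansion[OF assms(1)] by (rule has_sum_in_closure_cspan) simp
  then show ?thesis
    using assms(2) by (auto simp: is_onb_on_def)
qed

lemma cinner_frame_operator:
  fixes f :: "'i \<Rightarrow> 'a::chilbert"
  assumes "bessel f B"
  shows "cinner (synthesis f (analysis f x)) x = complex_of_real ((norm (analysis f x))\<^sup>2)"
  by (simp only: cinner_synthesis[OF assms] cinner_self)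

text \<open>For \<open>t = A / B\<^sup>2\<close> the map \<open>h \<mapsto> h - t (S h - g)\<close> is a contraction, because the frame
  operator \<open>S\<close> satisfies \<open>\<langle>S h, h\<rangle> \<ge> A \<parallel>h\<parallel>\<^sup>2\<close> and \<open>\<parallel>S h\<parallel> \<le> B \<parallel>h\<parallel>\<close>; its fixed point solves \<open>S h = g\<close>.\<close>

lemma frame_operator_surj:
  fixes f :: "'i \<Rightarrow> 'a::chilbert"
  assumes frame: "has_frame_bounds f UNIV A B" and "0 < A" "A \<le> B"
  shows "\<exists>h. synthesis f (analysis f h) = g"
proof -
  have "0 < B"
    using assms by simp
  have f: "bessel f B"
    using bessel_frame[OF frame] \<open>0 < B\<close> by simp
  define S where "S h = synthesis f (analysis f h)" for h
  have S_diff: "S (x - y) = S x - S y" for x y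
  proof -
    have "S (x - y + y) = S (x - y) + S y"
      by (simp only: S_def analysis_add[OF f] synthesis_add[OF f])
    then show ?thesis by simp
  qed
  have lower: "A * (norm d)\<^sup>2 \<le> inner (S d) d" for d
  proof -
    have "inner (S d) d = (norm (analysis f d))\<^sup>2"
      unfolding inner_eq_Re_cinner S_def cinner_frame_operator[OF f] by simp
    moreover have "(sqrt A * norm d)\<^sup>2 \<le> (norm (analysis f d))\<^sup>2"
      using norm_analysis_frame_ge[OF frame, of d] \<open>0 < A\<close> \<open>0 < B\<close> by (intro power_mono) auto
    ultimately show ?thesis
      using \<open>0 < A\<close> by (simp add: power_mult_distrib)
  qed
  have upper: "norm (S d) \<le> B * norm d" for d
  proof -
    have "norm (S d) \<le> sqrt B * norm (analysis f d)"
      unfolding S_def by (rule norm_synthesis_le[OF f])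
    also have "\<dots> \<le> sqrt B * (sqrt B * norm d)"
      using norm_analysis_le[OF f] \<open>0 < B\<close> by (intro mult_left_mono) auto
    finally show ?thesis
      using \<open>0 < B\<close> by (simp flip: mult.assoc)
  qed
  define t where "t = A / B\<^sup>2"
  \<comment> \<open>The bound \<open>1 - 2 * t * A + t^2 * B^2\<close> on the squared contraction
    factor is smallest at this \<open>t\<close>, with value \<open>q\<close>.\<close>
  define q where "q = 1 - A\<^sup>2 / B\<^sup>2"
  have "A\<^sup>2 \<le> B\<^sup>2"
    using assms by (intro power_mono) auto
  then have "0 \<le> q" "q < 1"
    using \<open>0 < A\<close> \<open>0 < B\<close> by (simp_all add: q_def)
  have contract: "norm (d - t *\<^sub>R S d) \<le> sqrt q * norm d" for d
  proof (rule power2_le_imp_le)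
    have "(norm (d - t *\<^sub>R S d))\<^sup>2 = (norm d)\<^sup>2 - 2 * t * inner (S d) d + t\<^sup>2 * (norm (S d))\<^sup>2"
      unfolding power2_norm_eq_inner
      by (simp add: inner_diff_left inner_diff_right inner_commute[of d "S d"] power2_eq_square[of t]
          algebra_simps)
    also have "\<dots> \<le> (norm d)\<^sup>2 - 2 * t * (A * (norm d)\<^sup>2) + t\<^sup>2 * (B * norm d)\<^sup>2"
      using lower upper \<open>0 < A\<close> \<open>0 < B\<close>
      by (intro add_mono diff_mono mult_left_mono power_mono) (auto simp: t_def)
    also have "\<dots> = q * (norm d)\<^sup>2"
      using \<open>0 < B\<close> by (simp add: t_def q_def power2_eq_square field_simps)
    finally show "(norm (d - t *\<^sub>R S d))\<^sup>2 \<le> (sqrt q * norm d)\<^sup>2"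
      using \<open>0 \<le> q\<close> by (simp add: power_mult_distrib)
  qed (use \<open>0 \<le> q\<close> in simp)
  define T where "T h = h - t *\<^sub>R (S h - g)" for h
  have "dist (T x) (T y) \<le> sqrt q * dist x y" for x y
  proof -
    have "T x - T y = (x - y) - t *\<^sub>R S (x - y)"
      by (simp add: T_def S_diff algebra_simps)
    then show ?thesis
      using contract[of "x - y"] by (simp add: dist_norm)
  qed
  then have "\<exists>!h. T h = h"
    using \<open>0 \<le> q\<close> \<open>q < 1\<close> by (intro banach_fix_type[of "sqrt q"]) auto
  then obtain h where "T h = h"
    by blast
  then have "S h = g"
    using \<open>0 < A\<close> \<open>0 < B\<close> by (simp add: T_def t_def)
  then show ?thesis
    unfolding S_def ..
qed

text \<open>Pairing the image of \<open>x - y\<close> with \<open>x - y\<close> gives the squared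
  norm of its analysis, which the lower frame bound controls.\<close>

lemma frame_operator_inj:
  fixes f :: "'i \<Rightarrow> 'a::chilbert"
  assumes frame: "has_frame_bounds f UNIV A B" and "0 < A" "0 \<le> B"
    and eq: "synthesis f (analysis f x) = synthesis f (analysis f y)"
  shows "x = y"
proof -
  have f: "bessel f B"
    using frame \<open>0 \<le> B\<close> by (rule bessel_frame)
  have "synthesis f (analysis f x) = synthesis f (analysis f (x - y)) + synthesis f (analysis f y)"
    using analysis_add[OF f, of "x - y" y] by (simp flip: synthesis_add[OF f])
  then have "synthesis f (analysis f (x - y)) = 0"
    using eq by simp
  then have "norm (analysis f (x - y)) = 0"
    using cinner_frame_operator[OF f, of "x - y"] by simp
  then have "sqrt A * norm (x - y) \<le> 0"
    using norm_analysis_frame_ge[OF frame, of "x - y"] \<open>0 < A\<close> \<open>0 \<le> B\<close> by simp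
  then show ?thesis
    using \<open>0 < A\<close> by (simp add: mult_le_0_iff)
qed

section \<open>Weak R-duals of frames\<close>

locale weak_R_dual =
  fixes f u v w :: "'i \<Rightarrow> 'a::chilbert" and A B :: real
  assumes frame: "has_frame_bounds f UNIV A B" and A_pos: "0 < A" and A_le_B: "A \<le> B"
    and u: "is_parseval_frame u" and v: "is_parseval_frame v"
    and weak_R_dual: "is_weak_R_dual w f u v"
begin

lemma B_pos: "0 < B"
  using A_pos A_le_B by simp

lemma bessel_f: "bessel f B"
  using bessel_frame[OF frame] B_pos by simp

lemmas bessel_v = bessel_parseval_frame[OF v]

section \<open>The operator \<open>L\<close>, its range and its intertwining of the frame
  operators\<close>

abbreviation S :: "'a \<Rightarrow> 'a"
  where "S h \<equiv> synthesis f (analysis f h)"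

definition L :: "'a \<Rightarrow> 'a"
  where "L h = synthesis v (cnj_ell2 (analysis f h))"

lemma L_add: "L (g + h) = L g + L h"
  by (simp add: L_def analysis_add[OF bessel_f] cnj_ell2_add synthesis_add[OF bessel_v])

lemma L_scaleC: "L (a *\<^sub>C h) = cnj a *\<^sub>C L h"
  by (simp add: L_def analysis_scaleC[OF bessel_f] cnj_ell2_scaleC synthesis_scaleC[OF bessel_v])

lemma bounded_linear_L: "bounded_linear L"
proof (rule bounded_linear_intro)
  show "norm (L h) \<le> norm h * sqrt B" for h
    using norm_synthesis_le[OF bessel_v, of "cnj_ell2 (analysis f h)"] norm_analysis_le[OF bessel_f, of h]
    by (simp add: L_def norm_cnj_ell2 mult.commute)
qed (simp_all add: L_add L_scaleC scaleR_scaleC)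

lemma L_u: "L (u j) = w j"
proof -
  have "ell2_coeff (cnj_ell2 (analysis f (u j))) i = cinner (f i) (u j)" for i
    unfolding cnj_ell2.rep_eq ell2_coeff_analysis[OF bessel_f] by (rule cinner_commute[symmetric])
  then show ?thesis
    using weak_R_dual by (simp add: L_def synthesis_def is_weak_R_dual_def)
qed

lemma has_sum_L: "((\<lambda>j. cnj (cinner h (u j)) *\<^sub>C w j) has_sum L h) UNIV"
  using has_sum_bounded_linear[OF bounded_linear_L parseval_expansion[OF u, of h]]
  by (simp add: L_scaleC L_u)

text \<open>The difference of the two sides is the entry at \<open>i\<close>, \<open>j\<close> of
  the product that the matrix equation sets to zero.\<close>

lemma cinner_w_v: "cinner (w j) (v i) = cinner (f i) (u j)"
proof -
  have "((\<lambda>k. cnj (cinner (u j) (f k)) *\<^sub>C v k) has_sum L (u j)) UNIV"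
    using has_sum_synthesis[OF bessel_v, of "cnj_ell2 (analysis f (u j))"]
    by (simp add: L_def cnj_ell2.rep_eq ell2_coeff_analysis[OF bessel_f])
  from has_sum_cinner_left[OF this, of "v i"]
  have "((\<lambda>k. cinner (f k) (u j) * cinner (v k) (v i)) has_sum cinner (w j) (v i)) UNIV"
    unfolding cinner_scaleC_left cinner_commute[of "f _", symmetric] L_u .
  \<comment> \<open>Summing the identity part separately shows that the product entry converges, so
    its vanishing is not just the default value 0.\<close>
  moreover have "((\<lambda>k. of_bool (i = k) * cinner (f k) (u j)) has_sum cinner (f i) (u j)) UNIV"
    by (rule has_sum_finite_neutralI[of "{i}"]) auto
  ultimately have "((\<lambda>k. cinner (f k) (u j) * cinner (v k) (v i) + - (of_bool (i = k) * cinner (f k) (u j)))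
      has_sum (cinner (w j) (v i) + - cinner (f i) (u j))) UNIV"
    by (intro has_sum_add has_sum_uminusI)
  then have "((\<lambda>k. (gram v v k i - of_bool (i = k)) * gram f u k j)
      has_sum (cinner (w j) (v i) - cinner (f i) (u j))) UNIV"
    by (simp add: gram_def algebra_simps)
  then have "inf_mat_mult (\<lambda>i k. gram v v k i - of_bool (i = k)) (gram f u) i j
      = cinner (w j) (v i) - cinner (f i) (u j)"
    unfolding inf_mat_mult_def by (rule infsumI)
  then show ?thesis
    using weak_R_dual by (simp add: is_weak_R_dual_def)
qed

text \<open>Extends \<open>cinner_w_v\<close> from the vectors \<open>u j\<close> to all
  \<open>h\<close> by the Parseval expansion in \<open>u\<close>.\<close>

lemma cinner_L_v: "cinner (L h) (v i) = cinner (f i) h"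
proof -
  have "((\<lambda>j. cinner (cnj (cinner h (u j)) *\<^sub>C w j) (v i)) has_sum cinner (L h) (v i)) UNIV"
    by (rule has_sum_cinner_left[OF has_sum_L])
  moreover have "((\<lambda>j. cinner (f i) (cinner h (u j) *\<^sub>C u j)) has_sum cinner (f i) h) UNIV"
    by (rule has_sum_cinner_right[OF parseval_expansion[OF u]])
  ultimately show ?thesis
    unfolding cinner_scaleC_left cinner_scaleC_right cinner_w_v by (rule has_sum_unique)
qed

lemma analysis_v_L: "analysis v (L h) = cnj_ell2 (analysis f h)"
  by (rule ell2_eqI)
    (simp add: ell2_coeff_analysis[OF bessel_v] ell2_coeff_analysis[OF bessel_f] cnj_ell2.rep_eq
      cinner_L_v cinner_commute[symmetric])

text \<open>Analysis by \<open>v\<close> is isometric and turns \<open>L\<close> into the conjugated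
  analysis of \<open>f\<close>; the conjugation swaps the arguments.\<close>

lemma cinner_L_L: "cinner (L g) (L h) = cinner (S h) g"
proof -
  have "cinner (L g) (L h) = cnj (cinner (analysis f g) (analysis f h))"
    by (simp add: analysis_v_L cinner_cnj_ell2 flip: cinner_analysis_parseval[OF v])
  then show ?thesis
    by (simp add: cinner_synthesis[OF bessel_f] flip: cinner_commute)
qed

lemma norm_L: "norm (L h) = norm (analysis f h)"
proof (rule power2_eq_imp_eq)
  show "(norm (L h))\<^sup>2 = (norm (analysis f h))\<^sup>2"
    using cmod_cinner_self[of "L h"] by (simp add: cinner_L_L cinner_frame_operator[OF bessel_f] norm_power)
qed simp_all

lemma norm_L_ge: "sqrt A * norm h \<le> norm (L h)"
  unfolding norm_L using norm_analysis_frame_ge[OF frame] A_pos B_pos by simp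

lemma L_eq_0_iff: "L h = 0 \<longleftrightarrow> h = 0"
proof
  assume "L h = 0"
  then show "h = 0"
    using norm_L_ge[of h] A_pos by (simp add: mult_le_0_iff)
qed (use linear_0[OF bounded_linear.linear[OF bounded_linear_L]] in simp)

lemma L_eq_iff: "L g = L h \<longleftrightarrow> g = h"
proof -
  have "L g = L h \<longleftrightarrow> L (g - h) = 0"
    by (simp add: linear_diff[OF bounded_linear.linear[OF bounded_linear_L]])
  then show ?thesis
    by (simp add: L_eq_0_iff)
qed

text \<open>Being bounded below, \<open>L\<close> has a complete and hence closed range. It contains
  every \<open>w j\<close>, and \<open>has_sum_L\<close> expands each of its elements in
  \<open>w\<close>.\<close>

lemma closure_cspan_w: "closure (cspan (range w)) = range L"
proof
  have "complete (range L)"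
    using A_pos norm_L_ge by (intro complete_isometric_image[of "sqrt A"] bounded_linear_L complete_UNIV) auto
  moreover have "complex_vector.subspace (range L)"
  proof (unfold complex_vector.subspace_def, intro conjI ballI allI)
    show "0 \<in> range L"
      using L_eq_0_iff[of 0] by (intro range_eqI[of _ _ 0]) simp
    show "x + y \<in> range L" if "x \<in> range L" "y \<in> range L" for x y
      using that by (auto simp flip: L_add)
    show "a *\<^sub>C x \<in> range L" if "x \<in> range L" for a x
    proof -
      from that obtain h where "x = L h" by blast
      then have "a *\<^sub>C x = L (cnj a *\<^sub>C h)"
        by (simp add: L_scaleC)
      then show ?thesis by simp
    qed
  qed
  moreover have "range w \<subseteq> range L"
    using L_u by (metis image_subsetI rangeI)
  ultimately show "closure (cspan (range w)) \<subseteq> range L"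
    by (intro closure_minimal complex_vector.span_minimal complete_imp_closed)
  show "range L \<subseteq> closure (cspan (range w))"
    using has_sum_in_closure_cspan[OF has_sum_L] by auto
qed

text \<open>As \<open>w j = L (u j)\<close>, \<open>cinner_L_L\<close> shows that the frame
  coefficients of \<open>L h\<close> are those with which \<open>has_sum_L\<close> expands
  \<open>L (S h)\<close>.\<close>

lemma frame_operator_w_L: "frame_operator w (L h) = L (S h)"
proof -
  have "cinner (L h) (w j) = cnj (cinner (S h) (u j))" for j
  proof -
    have "cinner (L h) (w j) = cnj (cinner (w j) (L h))"
      by (rule cinner_commute)
    then show ?thesis
      unfolding L_u[symmetric] cinner_L_L .
  qed
  then show ?thesis
    unfolding frame_operator_def using has_sum_L[of "S h"] by (simp add: infsumI)
qed

section \<open>The inverse frame operator of \<open>f\<close> and the canonical dual of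
  \<open>w\<close>\<close>

definition P :: "'a \<Rightarrow> 'a"
  where "P g = (SOME h. S h = g)"

lemma S_P: "S (P g) = g"
  unfolding P_def using frame_operator_surj[OF frame A_pos A_le_B] by (rule someI_ex)

lemma S_inj: "S g = S h \<Longrightarrow> g = h"
  using frame_operator_inj[OF frame A_pos] B_pos by simp

lemma P_add: "P (g + h) = P g + P h"
  by (rule S_inj) (simp add: S_P analysis_add[OF bessel_f] synthesis_add[OF bessel_f])

lemma P_scaleC: "P (a *\<^sub>C g) = a *\<^sub>C P g"
  by (rule S_inj) (simp add: S_P analysis_scaleC[OF bessel_f] synthesis_scaleC[OF bessel_f])

text \<open>By the intertwining relation, inverting the frame operator of \<open>w\<close> on the
  range of \<open>L\<close> amounts to inverting \<open>S\<close> before applying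
  \<open>L\<close>.\<close>

lemma canonical_dual_w: "canonical_dual w k = L (P (u k))"
  unfolding canonical_dual_def closure_cspan_w
proof (rule inv_into_f_eq)
  show "inj_on (frame_operator w) (range L)"
    by (auto simp: inj_on_def frame_operator_w_L L_eq_iff dest: S_inj)
  show "frame_operator w (L (P (u k))) = w k"
    by (simp add: frame_operator_w_L S_P L_u)
qed simp

text \<open>Continuity allows the composite to pass through infinite sums. The bound comes from the
  squared norm of \<open>L (P g)\<close> being the inner product of \<open>g\<close> with
  \<open>P g\<close>, and from \<open>L\<close> being bounded below.\<close>

lemma bounded_linear_L_P: "bounded_linear (\<lambda>g. L (P g))"
proof (rule bounded_linear_intro)
  show "norm (L (P g)) \<le> norm g * (1 / sqrt A)" for g
  proof -
    have "norm (L (P g)) * norm (L (P g)) = cmod (cinner g (P g))"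
      using cmod_cinner_self[of "L (P g)"] by (simp add: cinner_L_L S_P power2_eq_square)
    also have "\<dots> \<le> norm g * norm (P g)"
      by (rule cmod_cinner_le)
    also have "\<dots> \<le> norm g * (norm (L (P g)) / sqrt A)"
      using norm_L_ge[of "P g"] A_pos by (intro mult_left_mono) (simp_all add: field_simps)
    finally have *: "norm (L (P g)) * norm (L (P g)) \<le> (norm g * (1 / sqrt A)) * norm (L (P g))"
      by simp
    show ?thesis
    proof (cases "L (P g) = 0")
      case False
      then show ?thesis
        using mult_right_le_imp_le[OF *] by simp
    qed (use A_pos in simp)
  qed
qed (simp_all add: L_add P_add L_scaleC P_scaleC scaleR_scaleC)

section \<open>The sequence \<open>y\<close> and the kernel of its synthesis operator\<close>

lemma L_P_eq_0_iff: "L (P g) = 0 \<longleftrightarrow> g = 0"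
proof
  assume "L (P g) = 0"
  then have "P g = P 0"
    using L_eq_0_iff linear_0[OF bounded_linear.linear[OF bounded_linear_L_P]] by metis
  then show "g = 0"
    using S_P by metis
qed (use linear_0[OF bounded_linear.linear[OF bounded_linear_L_P]] in simp)

text \<open>Apply the conjugate-linear composite of \<open>L\<close> and \<open>P\<close> to the
  Parseval expansion of \<open>h\<close>. At \<open>h = f i\<close> the left side is the definition
  of \<open>y i\<close>.\<close>

lemma infsum_canonical_dual: "(\<Sum>\<^sub>\<infinity>k. cinner (u k) h *\<^sub>C canonical_dual w k) = L (P h)"
proof (rule infsumI)
  have "((\<lambda>k. L (P (cinner h (u k) *\<^sub>C u k))) has_sum L (P h)) UNIV"
    by (rule has_sum_bounded_linear[OF bounded_linear_L_P parseval_expansion[OF u]])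
  then show "((\<lambda>k. cinner (u k) h *\<^sub>C canonical_dual w k) has_sum L (P h)) UNIV"
    unfolding P_scaleC L_scaleC canonical_dual_w cinner_commute[of "u _" h] .
qed

lemma synthesis_L_P: "synthesis (\<lambda>i. L (P (f i))) c = L (P (synthesis f (cnj_ell2 c)))"
  unfolding synthesis_def[of "\<lambda>i. L (P (f i))"]
proof (rule infsumI)
  have "((\<lambda>i. L (P (ell2_coeff (cnj_ell2 c) i *\<^sub>C f i))) has_sum L (P (synthesis f (cnj_ell2 c)))) UNIV"
    by (rule has_sum_bounded_linear[OF bounded_linear_L_P has_sum_synthesis[OF bessel_f]])
  then show "((\<lambda>i. ell2_coeff c i *\<^sub>C L (P (f i))) has_sum L (P (synthesis f (cnj_ell2 c)))) UNIV"
    by (simp add: P_scaleC L_scaleC cnj_ell2.rep_eq)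
qed

text \<open>The composite of \<open>L\<close> and \<open>P\<close> is injective, so only the
  synthesis of \<open>f\<close> after conjugation matters; its adjoint is, up to conjugation, the
  analysis by \<open>v\<close> of \<open>L h\<close>. Writing the kernel as an orthogonal complement
  makes \<open>hdim_isometric_embedding\<close> applicable.\<close>

lemma kernel_synthesis:
  "{c. synthesis (\<lambda>i. L (P (f i))) c = 0} = ortho_complement (range (\<lambda>h. analysis v (L h)))"
proof -
  have "synthesis f (cnj_ell2 c) = 0 \<longleftrightarrow> (\<forall>h. cinner (synthesis f (cnj_ell2 c)) h = 0)" for c
    by (metis cinner_self_eq_zero cinner_zero_left)
  then show ?thesis
    unfolding synthesis_L_P L_P_eq_0_iff ortho_complement_def cinner_synthesis[OF bessel_f]
    by (auto simp: cinner_cnj_ell2 analysis_v_L)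
qed

end

theorem theorem2p6:
  fixes f u v w y :: "'i::countable \<Rightarrow> 'a::chilbert"
  assumes "separable_space (euclidean :: 'a topology)"
    and "hdim (UNIV :: 'a set) = \<infinity>"
    and "is_frame f"
    and "is_parseval_frame u"
    and "is_parseval_frame v"
    and "\<not> is_onb_on UNIV v UNIV"
    and "is_weak_R_dual w f u v"
    and "\<And>i. y i = (\<Sum>\<^sub>\<infinity>k. cinner (u k) (f i) *\<^sub>C canonical_dual w k)"
  shows "hdim (ortho_complement (cspan (range w))) \<le> hdim {c. synthesis y c = 0} \<and>
    (hdim (ortho_complement (cspan (range w))) < \<infinity> \<longrightarrow>
      hdim (ortho_complement (cspan (range w))) < hdim {c. synthesis y c = 0})"
proof -
  let ?N = "ortho_complement (cspan (range w))"
  obtain A B where "has_frame_bounds f UNIV A B" "0 < A" "A \<le> B"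
    using \<open>is_frame f\<close> unfolding is_frame_def by blast
  then interpret weak_R_dual f u v w A B
    using assms(4,5,7) by unfold_locales
  have y: "y = (\<lambda>i. L (P (f i)))"
    by (rule ext) (simp add: assms(8) infsum_canonical_dual)
  obtain i j where ij: "cinner (v i) (v j) \<noteq> of_bool (i = j)"
    using parseval_frame_onbI[OF v] \<open>\<not> is_onb_on UNIV v UNIV\<close> by blast
  \<comment> \<open>The component of a unit vector orthogonal to the range of the analysis operator
    of \<open>v\<close>. Its coefficient at \<open>j\<close> is the Gram defect found above.\<close>
  define c where "c = unit_ell2 i - analysis v (v i)"
  have "ell2_coeff c j \<noteq> 0"
    using ij by (simp add: c_def ell2_coeff_diff ell2_coeff_unit_ell2 ell2_coeff_analysis[OF bessel_v]
        eq_commute[of j])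
  then have "c \<noteq> 0"
    by (auto simp: zero_ell2.rep_eq)
  have c_orth: "cinner c (analysis v x) = 0" for x
    by (simp add: c_def cinner_diff_left cinner_unit_ell2 cinner_analysis_parseval[OF v]
        ell2_coeff_analysis[OF bessel_v] flip: cinner_commute)
  show ?thesis
    unfolding y kernel_synthesis
  proof (rule hdim_isometric_embedding)
    show "cinner (analysis v x) (analysis v x') = cinner x x'" for x x'
      by (rule cinner_analysis_parseval[OF v])
    show "analysis v x \<in> ortho_complement (range (\<lambda>h. analysis v (L h)))" if "x \<in> ?N" for x
    proof -
      \<comment> \<open>Analysis by \<open>v\<close> preserves inner products, so it suffices that
        \<open>x\<close> is orthogonal to the range of \<open>L\<close>, which is the closed span of
        \<open>w\<close>.\<close>
      have "cinner (L h) x = 0" for h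
      proof (rule cinner_closure_cspan_eq_0)
        show "L h \<in> closure (cspan (range w))"
          by (simp add: closure_cspan_w)
        show "cinner z x = 0" if "z \<in> range w" for z
          using \<open>x \<in> ?N\<close> that complex_vector.span_base[of z "range w"]
          by (simp add: ortho_complement_def cinner_eq_zero_commute[of z])
      qed
      then show ?thesis
        by (auto simp: ortho_complement_def cinner_analysis_parseval[OF v] cinner_eq_zero_commute[of x])
    qed
    \<comment> \<open>Orthogonality to the whole range of the analysis of \<open>v\<close> puts
      \<open>c\<close> in the kernel and also makes it orthogonal to the embedded copy of
      \<open>?N\<close>.\<close>
    show "c \<in> ortho_complement (range (\<lambda>h. analysis v (L h)))"
      by (auto simp: ortho_complement_def c_orth)
  qed (fact \<open>c \<noteq> 0\<close>, rule c_orth)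
qed

end
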